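(* Let $k_1,k_2\in\mathbb N\cup\{0\}$ and let $T^{k_1(1)}, T^{k_2(2)}$ be $k_1$- and $k_2$-punctured ball tangle diagrams, respectively. If $$F^{k_1}(T^{k_1(1)})=\left[\begin{matrix} a_{11}&a_{12}&\cdots&a_{1\,2^{k_1}} \\ a_{21}&a_{22}&\cdots&a_{2\,2^{k_1}}\end{matrix}\right],\qquad F^{k_2}(T^{k_2(2)})=\left[\begin{matrix} b_{11}&b_{12}&\cdots&b_{1\,2^{k_2}} \\ b_{21}&b_{22}&\cdots&b_{2\,2^{k_2}}\end{matrix}\right],$$ then (1) $F^{k_1+k_2}(T^{k_1(1)}+_hT^{k_2(2)})=\left[\left(\begin{pmatrix}a_{1i}b_{2j}+a_{2i}b_{1j} \\ a_{2i}b_{2j}\end{pmatrix}_{j=1,\dots,2^{k_2}}\right)_{i=1,\dots,2^{k_1}}\right]$, (2) $F^{k_1+k_2}(T^{k_1(1)}+_vT^{k_2(2)})=\left[\left(\begin{pmatrix}a_{1i}b_{1j} \\ a_{2i}b_{1j}+a_{1i}b_{2j}\end{pmatrix}_{j=1,\dots,2^{k_2}}\right)_{i=1,\dots,2^{k_1}}\right]$. Here the right-hand sides denote classes modulo $\pm1$ of $2\times 2^{k_1+k_2}$ matrices whose columns are the displayed ones, indexed by the pairs $(i,j)$ in lexicographic order (for each $i=1,\dots,2^{k_1}$ in turn, $j$ runs through $1,\dots,2^{k_2}$).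
   Context: Punctured ball tangles. For $n\ge 0$ let $H_0$ be a closed 3-ball and $H_1,\dots,H_n$ pairwise disjoint closed 3-balls in the interior of $H_0$, with four distinct marked points on each $\partial H_k$ ($0\le k\le n$). An $n$-punctured ball tangle is a 1-dimensional proper submanifold $T$ of $H_0-\bigcup_{i=1}^n \mathrm{Int}(H_i)$ with $\partial T$ equal to the set of all marked points. It is represented by a diagram (with over/under crossings) in a disc with $n$ ordered holes, where each of the $n+1$ boundary circles carries four marked points in the positions NW, NE, SW, SE. A ball tangle is a 0-punctured ball tangle. The first (numbered $1$) fundamental ball tangle is the crossingless diagram with two arcs joining NW to SW and NE to SE; the second (numbered $2$) is the crossingless diagram with two arcs joining NW to NE and SW to SE. The numerator closure of a ball tangle diagram joins, outside the disc and without crossings, NW to NE and SW to SE; the denominator closure joins NW to SW and NE to SE. Connect sums. The horizontal connect sum $T+_hT'$ places $T'$ to the right of $T$ and joins, without crossings, the outer points NE, SE of $T$ to the outer points NW, SW of $T'$ respectively; its outer endpoints are NW, SW of $T$ and NE, SE of $T'$. The vertical connect sum $T+_vT'$ places one of the diagrams above the other ($T$ above $T'$) and joins the outer points SW, SE of the upper one to the outer points NW, NE of the lower one respectively; its outer endpoints are NW, NE of the upper one and SW, SE of the lower one. In both cases the holes of the sum are ordered as: the holes of $T$ in order, then the holes of $T'$ in order. Kauffman bracket. Let $A=e^{i\pi/4}$. For a link diagram $L$, $\langle L\rangle=\sum_\sigma A^{\alpha(\sigma)-\beta(\sigma)}(-A^2-A^{-2})^{d(\sigma)-1}$, where $\sigma$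 runs over all states (a choice of $A$-type or $B$-type splitting at every crossing; the $A$-type splitting joins the two regions swept out by rotating the overcrossing strand counterclockwise, the $B$-type splitting joins the other two), $\alpha(\sigma),\beta(\sigma)$ are the numbers of $A$- and $B$-splittings, and $d(\sigma)$ is the number of circles of the resulting crossingless diagram. Since $-A^2-A^{-2}=0$, only states with $d(\sigma)=1$ contribute (convention $0^0=1$). The invariant. $PM_{m\times l}(\mathbb Z)$ is the set of $m\times l$ integer matrices modulo multiplication by $\pm1$; $[M]=\{M,-M\}$ is the class of $M$. Let $\Phi=\{z\in\mathbb C: z^8=1\}$. Let $\alpha^n_1<\cdots<\alpha^n_{2^n}$ be the elements of $\{1,2\}^n$ in lexicographic order, $\alpha^n_{lj}$ the $j$-th coordinate of $\alpha^n_l$, and $t_l$ the number of coordinates of $\alpha^n_l$ equal to $2$. For an $n$-punctured ball tangle diagram $T^n$ and $\epsilon\in\{1,2\}$, let $T^n_{\epsilon\alpha^n_l}$ be the link diagram obtained by filling the $j$-th hole of $T^n$ with fundamental ball tangle number $\alpha^n_{lj}$ for each $j$ (matching NW, NE, SW, SE) and then taking the numerator closure if $\epsilon=1$, the denominator closure if $\epsilon=2$. Then $$F^n(T^n)=\left\{\begin{pmatrix}(-i)^{t_1}z\langle T^n_{1\alpha^n_1}\rangle&\cdots&(-i)^{t_{2^n}}z\langle T^n_{1\alpha^n_{2^n}}\rangle \\ (-i)^{t_1}iz\langle T^n_{2\alpha^n_1}\rangle&\cdots&(-i)^{t_{2^n}}iz\langle T^n_{2\alpha^n_{2^n}}\rangle\end{pmatrix}: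 z\in\Phi\right\}\cap M_{2\times 2^n}(\mathbb Z),$$ which is an element of $PM_{2\times2^n}(\mathbb Z)$. For $n=0$ there are no holes and one column with $t_1=0$, so $F^0(B)$ is the class of a column $(z\langle B_1\rangle, iz\langle B_2\rangle)^{T}$, where $B_1,B_2$ are the numerator and denominator closures of $B$. *)

theory Defs
  imports Complex_Main "Jordan_Normal_Form.Matrix"
begin

section \<open>Diagrams\<close>

text \<open>
  A diagram is a plane graph, given by a planar diagram code: the edges carry labels, and each
  vertex lists the labels of the edges at it. Each label occurs exactly twice.

  \<^item> \<open>Crossing a b c d\<close>: the four edges at a crossing in counterclockwise order; \<open>a\<close> and \<open>c\<close>
    are the two ends of the undercrossing strand, \<open>b\<close> and \<open>d\<close> those of the overcrossing strand.
  \<^item> A pair \<open>(a, b)\<close> is a joint, a bivalent vertex subdividing a strand. Joints are where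
    diagrams are glued, and they allow circles without crossings: \<open>(a, a)\<close> is one.
  \<^item> \<open>Quad nw ne sw se\<close>: the edges at the four marked points of a boundary circle, either
    a hole or the outer circle.
\<close>

datatype 'a crossing = Crossing 'a 'a 'a 'a

datatype 'a quad = Quad (NW: 'a) (NE: 'a) (SW: 'a) (SE: 'a)

datatype 'a tangle_diagram =
  Tangle (crossings: "'a crossing list") (joints: "('a \<times> 'a) list")
    (holes: "'a quad list") (outer: "'a quad")

datatype 'a link_diagram =
  Link (link_crossings: "'a crossing list") (link_joints: "('a \<times> 'a) list")

text \<open>Number of connected components of the graph on \<open>S\<close> with edge set \<open>r \<subseteq> S \<times> S\<close>.\<close>

definition num_components :: "'a set \<Rightarrow> ('a \<times> 'a) set \<Rightarrow> nat" where
  "num_components S r = card (S // (r \<union> r\<inverse>)\<^sup>*)"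


subsection \<open>Planarity\<close>

text \<open>
  Shrinking each hole and the complement of the disc to a vertex turns a diagram into a graph on
  the 2-sphere. The lists below give the edges at each vertex in counterclockwise order. The
  cyclic order at the outer circle is opposite to that at a hole, as the outer circle is seen
  from the other side.
\<close>

fun crossing_cycle :: "'a crossing \<Rightarrow> 'a list" where
  "crossing_cycle (Crossing a b c d) = [a, b, c, d]"

fun joint_cycle :: "'a \<times> 'a \<Rightarrow> 'a list" where
  "joint_cycle (a, b) = [a, b]"

definition hole_cycle :: "'a quad \<Rightarrow> 'a list" where
  "hole_cycle q = [NE q, NW q, SW q, SE q]"

definition outer_cycle :: "'a quad \<Rightarrow> 'a list" where
  "outer_cycle q = [NE q, SE q, SW q, NW q]"

definition vertex_cycles :: "'a tangle_diagram \<Rightarrow> 'a list list" where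
  "vertex_cycles T = map crossing_cycle (crossings T) @ map joint_cycle (joints T) @
     map hole_cycle (holes T) @ [outer_cycle (outer T)]"

text \<open>A dart \<open>(v, k)\<close> is the edge end in position \<open>k\<close> at the vertex \<open>v\<close>.\<close>

definition darts :: "'a list list \<Rightarrow> (nat \<times> nat) set" where
  "darts R = {(v, k). v < length R \<and> k < length (R ! v)}"

definition dart_label :: "'a list list \<Rightarrow> nat \<times> nat \<Rightarrow> 'a" where
  "dart_label R d = R ! fst d ! snd d"

definition next_dart :: "'a list list \<Rightarrow> nat \<times> nat \<Rightarrow> nat \<times> nat" where
  "next_dart R d = (fst d, Suc (snd d) mod length (R ! fst d))"

text \<open>
  Tracing the boundary of a face: traverse an edge from the dart \<open>d\<close> to its other end \<open>d'\<close>,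
  then turn to the dart next to \<open>d'\<close>.
\<close>

definition face_steps :: "'a list list \<Rightarrow> ((nat \<times> nat) \<times> (nat \<times> nat)) set" where
  "face_steps R = {(d, next_dart R d') | d d'. d \<in> darts R \<and> d' \<in> darts R \<and> d \<noteq> d' \<and>
     dart_label R d = dart_label R d'}"

definition edge_labels :: "'a list list \<Rightarrow> 'a set" where
  "edge_labels R = \<Union> (set ` set R)"

text \<open>
  Euler's formula, for a graph that need not be connected. The faces are counted separately for
  each connected component, so that each component contributes \<open>2 - 2 * genus\<close> to the left-hand
  side, and the equality says that all of them are spherical. How components of a split diagram
  lie in the regions of each other is not recorded.
\<close>

definition planar_cycles :: "'a list list \<Rightarrow> bool" where
  "planar_cycles R \<longleftrightarrow>
     int (length R) - int (card (edge_labels R)) + int (num_components (darts R) (face_steps R))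
     = 2 * int (num_components (edge_labels R) {(a, b). \<exists>r \<in> set R. a \<in> set r \<and> b \<in> set r})"

definition punctured_ball_tangle_diagram :: "nat \<Rightarrow> 'a tangle_diagram \<Rightarrow> bool" where
  "punctured_ball_tangle_diagram n T \<longleftrightarrow>
     length (holes T) = n \<and>
     (\<forall>a \<in> edge_labels (vertex_cycles T). count_list (concat (vertex_cycles T)) a = 2) \<and>
     planar_cycles (vertex_cycles T)"


subsection \<open>Connect sums\<close>

text \<open>The labels of the two diagrams are made disjoint by \<open>Inl\<close> and \<open>Inr\<close>.\<close>

definition hsum :: "'a tangle_diagram \<Rightarrow> 'b tangle_diagram \<Rightarrow> ('a + 'b) tangle_diagram"
  (infixl "+\<^sub>h" 65) where
  "T +\<^sub>h T' = (let L = map_tangle_diagram Inl T; R = map_tangle_diagram Inr T' in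
     Tangle (crossings L @ crossings R)
       (joints L @ joints R @ [(NE (outer L), NW (outer R)), (SE (outer L), SW (outer R))])
       (holes L @ holes R)
       (Quad (NW (outer L)) (NE (outer R)) (SW (outer L)) (SE (outer R))))"

definition vsum :: "'a tangle_diagram \<Rightarrow> 'b tangle_diagram \<Rightarrow> ('a + 'b) tangle_diagram"
  (infixl "+\<^sub>v" 65) where
  "T +\<^sub>v T' = (let U = map_tangle_diagram Inl T; D = map_tangle_diagram Inr T' in
     Tangle (crossings U @ crossings D)
       (joints U @ joints D @ [(SW (outer U), NW (outer D)), (SE (outer U), NE (outer D))])
       (holes U @ holes D)
       (Quad (NW (outer U)) (NE (outer U)) (SW (outer D)) (SE (outer D))))"


subsection \<open>Filling holes and closing up\<close>

text \<open>The two arcs of the fundamental ball tangles 1 and 2, between four given edges.\<close>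

definition fundamental_arcs :: "nat \<Rightarrow> 'a quad \<Rightarrow> ('a \<times> 'a) list" where
  "fundamental_arcs i q =
     (if i = 1 then [(NW q, SW q), (NE q, SE q)] else [(NW q, NE q), (SW q, SE q)])"

text \<open>The outside arcs of the numerator closure (1) and of the denominator closure (2).\<close>

definition closure_arcs :: "nat \<Rightarrow> 'a quad \<Rightarrow> ('a \<times> 'a) list" where
  "closure_arcs e q =
     (if e = 1 then [(NW q, NE q), (SW q, SE q)] else [(NW q, SW q), (NE q, SE q)])"

text \<open>The link diagram \<open>T\<^bsub>e \<alpha>\<^esub>\<close> for \<open>e \<in> {1, 2}\<close> and \<open>\<alpha> \<in> {1, 2}\<^sup>n\<close>.\<close>

definition fill_close :: "'a tangle_diagram \<Rightarrow> nat \<Rightarrow> nat list \<Rightarrow> 'a link_diagram" where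
  "fill_close T e \<alpha> = Link (crossings T)
     (joints T @ concat (map2 fundamental_arcs \<alpha> (holes T)) @ closure_arcs e (outer T))"


section \<open>The Kauffman bracket\<close>

definition kauffman_A :: complex where
  "kauffman_A = exp (\<i> * of_real pi / 4)"

text \<open>
  Rotating the overcrossing strand \<open>b\<close>--\<open>d\<close> counterclockwise sweeps out the region between \<open>b\<close>
  and \<open>c\<close> and the region between \<open>d\<close> and \<open>a\<close>. Joining these (the A-type splitting, \<open>True\<close>)
  leaves the strands \<open>a\<close>--\<open>b\<close> and \<open>c\<close>--\<open>d\<close>.
\<close>

fun splitting :: "bool \<Rightarrow> 'a crossing \<Rightarrow> ('a \<times> 'a) list" where
  "splitting True (Crossing a b c d) = [(a, b), (c, d)]"
| "splitting False (Crossing a b c d) = [(b, c), (d, a)]"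

definition state_arcs :: "'a link_diagram \<Rightarrow> bool list \<Rightarrow> ('a \<times> 'a) list" where
  "state_arcs L \<sigma> = link_joints L @ concat (map2 splitting \<sigma> (link_crossings L))"

text \<open>
  As every label occurs twice in a crossingless diagram made of joints, its circles are its
  connected components.
\<close>

definition num_circles :: "('a \<times> 'a) list \<Rightarrow> nat" where
  "num_circles arcs = num_components (fst ` set arcs \<union> snd ` set arcs) (set arcs)"

definition kauffman_bracket :: "'a link_diagram \<Rightarrow> complex" where
  "kauffman_bracket L =
     (\<Sum>\<sigma> | length \<sigma> = length (link_crossings L).
        kauffman_A powi (int (count_list \<sigma> True) - int (count_list \<sigma> False)) *
        (- (kauffman_A powi 2) - kauffman_A powi (-2)) ^ (num_circles (state_arcs L \<sigma>) - 1))"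


section \<open>The invariant\<close>

text \<open>The class of a matrix modulo multiplication by 1 and -1.\<close>

definition pm_class :: "int mat \<Rightarrow> int mat set" where
  "pm_class M = {M, - M}"

definition Phi :: "complex set" where
  "Phi = {z. z ^ 8 = 1}"

text \<open>The elements of \<open>{1, 2}\<^sup>n\<close> in lexicographic order.\<close>

definition index_lists :: "nat \<Rightarrow> nat list list" where
  "index_lists n = product_lists (replicate n [1, 2])"

text \<open>Rows and columns are numbered from 0, so row \<open>r\<close> belongs to the closure \<open>Suc r\<close>.\<close>

definition invariant_matrix :: "nat \<Rightarrow> 'a tangle_diagram \<Rightarrow> complex \<Rightarrow> complex mat" where
  "invariant_matrix n T z = mat 2 (2 ^ n) (\<lambda>(r, l).
     let \<alpha> = index_lists n ! l in
       (- \<i>) ^ count_list \<alpha> 2 * \<i> ^ r * z * kauffman_bracket (fill_close T (Suc r) \<alpha>))"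

definition tangle_invariant :: "nat \<Rightarrow> 'a tangle_diagram \<Rightarrow> int mat set" where
  "tangle_invariant n T = {M \<in> carrier_mat 2 (2 ^ n).
     \<exists>z \<in> Phi. map_mat of_int M = invariant_matrix n T z}"

end

theory Submission
  imports Defs
begin

text \<open>
  At \<open>A = exp (i \<pi> / 4)\<close> the loop value vanishes, so the bracket counts, with weights
  \<open>A\<^sup>\<alpha>\<^sup>-\<^sup>\<beta>\<close>, the states with a single circle. After the holes have been filled
  and a state has been chosen, a diagram in the disc consists of closed circles and of two paths
  that join the four outer ends in pairs. In the plane the paths cannot cross, so the state joins
  the ends either horizontally (NW to NE and SW to SE) or vertically (NW to SW and NE to SE). If
  there are no closed circles, the numerator closure is a single circle exactly for the vertical
  states and the denominator closure exactly for the horizontal ones. A horizontal sum of two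
  states has a single circle in its numerator closure exactly when one summand is vertical and the
  other horizontal, and in its denominator closure exactly when both are horizontal
  (\<open>connected_glue_numerator\<close>, \<open>connected_glue_denominator\<close>). Summing over all pairs
  of states expresses the brackets of the sum through those of the summands
  (\<open>kauffman_bracket_hsum\<close>). Reflection in the diagonal of the disc, which exchanges NE with SW
  and the two closures, turns a vertical sum into a horizontal one.

  The brackets are multiplied by \<open>z\<close>, a power of \<open>-i\<close> that counts the indices 2, and a factor
  \<open>i\<close> in the second row. If \<open>z\<close> and \<open>w\<close> produce the given integer matrices of the two summands,
  then \<open>i z w\<close> produces the matrix of the horizontal sum and \<open>z w\<close> that of the vertical sum. Two
  integer matrices which differ by a complex factor of modulus 1 are equal up to sign, so one
  integer matrix determines the class (\<open>tangle_invariant_eq_pm_class\<close>).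

  The part that needs planarity is that no state joins NW to SE. The regions of a planar diagram
  can be coloured like a checkerboard, since all vertices have even degree. Seen from the edge
  ends, this is a 2-colouring that alternates around every vertex and differs at the two ends of
  every edge (\<open>planar_alternating_coloring\<close>). Splittings and fundamental tangles connect
  neighbouring edge ends, so every arc can be directed from one colour to the other. Each label has
  one end of either colour, hence the directed arcs of a state form a partial permutation of the
  labels. Two opposite outer ends, say NW and SE, are its sources and the other two its sinks, and
  the path that starts at a source must end at a sink (\<open>partial_permutation_joins\<close>).

  Planarity is given by Euler's formula, and the colouring follows from it by counting over the
  field with two elements. Consider the edge sets across which some colouring of the faces changes,
  and the edge sets across which some colouring of the vertices changes (the cuts). Any face
  coboundary meets any cut in an even number of edges. By rank and nullity there are at least
  \<open>2\<^sup>F\<^sup>-\<^sup>C\<close> of the former and \<open>2\<^sup>V\<^sup>-\<^sup>C\<close> of the latter, and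
  \<open>(F - C) + (V - C) = E\<close>. Two families of subsets of an \<open>E\<close>-element set with even intersections
  have at most \<open>2\<^sup>E\<close> pairs (\<open>card_orthogonal_families\<close>), so the face coboundaries are all the
  edge sets that meet every cut evenly. The set of all edges is one of them
  (\<open>planar_face_coloring\<close>).
\<close>

section \<open>Parity and orthogonal families of sets\<close>

lemma odd_card_filter_xor:
  assumes "finite X"
  shows "odd (card {d \<in> X. P d \<noteq> Q d}) \<longleftrightarrow> odd (card {d \<in> X. P d}) \<noteq> odd (card {d \<in> X. Q d})"
proof -
  have *: "card {d \<in> X. R d} = (\<Sum>d\<in>X. if R d then 1 else 0)" for R
    using assms by (simp add: sum.If_cases Int_def)
  show ?thesis unfolding *
    using assms by (induction X rule: finite_induct) auto
qed

lemma odd_card_changes: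
  fixes g :: "nat \<Rightarrow> bool"
  shows "odd (card {k. k < m \<and> g k \<noteq> g (Suc k)}) \<longleftrightarrow> g 0 \<noteq> g m"
proof (induction m)
  case (Suc m)
  have "{k. k < Suc m \<and> g k \<noteq> g (Suc k)} =
      {k. k < m \<and> g k \<noteq> g (Suc k)} \<union> (if g m \<noteq> g (Suc m) then {m} else {})"
    by (auto simp: less_Suc_eq)
  then show ?case using Suc by auto
qed simp

lemma even_card_cyclic_changes:
  fixes g :: "nat \<Rightarrow> bool"
  shows "even (card {k. k < n \<and> g k \<noteq> g (Suc k mod n)})"
proof -
  have "{k. k < n \<and> g k \<noteq> g (Suc k mod n)} =
      {k. k < n \<and> (\<lambda>k. g (k mod n)) k \<noteq> (\<lambda>k. g (k mod n)) (Suc k)}"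
    by auto
  then show ?thesis using odd_card_changes[of n "\<lambda>k. g (k mod n)"] by simp
qed

text \<open>
  The maps \<open>x \<mapsto> (-1)\<^bsup>card (x \<inter> b)\<^esup>\<close> are the characters of the group of subsets of \<open>E\<close>. For
  \<open>b \<noteq> b'\<close> the sum vanishes because toggling an element of the symmetric difference of \<open>b\<close> and
  \<open>b'\<close> in \<open>x\<close> changes the sign of the summand.
\<close>

lemma sum_Pow_character:
  assumes "finite E" "b \<subseteq> E" "b' \<subseteq> E"
  shows "(\<Sum>x\<in>Pow E. (- 1 :: int) ^ card (x \<inter> b) * (- 1) ^ card (x \<inter> b')) =
    (if b = b' then 2 ^ card E else 0)"
proof (cases "b = b'")
  case True
  have "(- 1 :: int) ^ k * (- 1) ^ k = 1" for k
    by (simp flip: power_mult_distrib)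
  then show ?thesis using True assms by (simp add: card_Pow)
next
  case False
  define \<chi> where "\<chi> x = (- 1 :: int) ^ card (x \<inter> b) * (- 1) ^ card (x \<inter> b')" for x
  obtain e where e: "e \<in> E" "e \<in> b \<longleftrightarrow> e \<notin> b'" using False assms by blast
  define t where "t x = (if e \<in> x then x - {e} else insert e x)" for x
  have tt: "t (t x) = x" for x by (auto simp: t_def)
  have bij: "bij_betw t (Pow E) (Pow E)"
    by (rule bij_betwI[where g = t]) (use e in \<open>auto simp: tt t_def split: if_splits\<close>)
  have card_in: "(- 1 :: int) ^ card (t x \<inter> c) = - ((- 1) ^ card (x \<inter> c))"
    if "x \<subseteq> E" "e \<in> c" for x c
  proof -
    have fin: "finite (x \<inter> c)" using that assms(1) finite_subset by blast
    show ?thesis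
    proof (cases "e \<in> x")
      case True
      then have "x \<inter> c = insert e (t x \<inter> c)" "e \<notin> t x \<inter> c" using that by (auto simp: t_def)
      with fin show ?thesis by simp
    next
      case False
      then have "t x \<inter> c = insert e (x \<inter> c)" "e \<notin> x \<inter> c" using that by (auto simp: t_def)
      with fin show ?thesis by simp
    qed
  qed
  have card_out: "t x \<inter> c = x \<inter> c" if "e \<notin> c" for x c
    using that by (auto simp: t_def)
  have "\<chi> (t x) = - \<chi> x" if "x \<in> Pow E" for x
  proof (cases "e \<in> b")
    case True
    then show ?thesis using e that card_in[of x b] card_out[of b' x] by (simp add: \<chi>_def)
  next
    case False
    then show ?thesis using e that card_in[of x b'] card_out[of b x] by (simp add: \<chi>_def)
  qed
  then have "(\<Sum>x\<in>Pow E. \<chi> (t x)) = - (\<Sum>x\<in>Pow E. \<chi> x)" by (simp add: sum_negf)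
  moreover have "(\<Sum>x\<in>Pow E. \<chi> (t x)) = (\<Sum>x\<in>Pow E. \<chi> x)"
    by (rule sum.reindex_bij_betw[OF bij])
  ultimately show ?thesis using False by (simp add: \<chi>_def)
qed

text \<open>
  Bessel's inequality for the characters above. The square of \<open>\<Sum>b\<in>B. (-1)\<^bsup>card (x \<inter> b)\<^esup>\<close>, summed
  over all \<open>x \<subseteq> E\<close>, is \<open>card B * 2\<^bsup>card E\<^esup>\<close> by orthogonality, and the terms with
  \<open>x \<in> Z\<close> alone contribute \<open>card Z * (card B)\<^sup>2\<close>.
\<close>

lemma card_orthogonal_families:
  assumes "finite E" "Z \<subseteq> Pow E" "B \<subseteq> Pow E"
    and orth: "\<And>z b. z \<in> Z \<Longrightarrow> b \<in> B \<Longrightarrow> even (card (z \<inter> b))"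
  shows "card Z * card B \<le> 2 ^ card E"
proof (cases "B = {}")
  case False
  have fin: "finite Z" "finite B" "finite (Pow E)"
    using assms finite_subset by (metis finite_Pow_iff)+
  define \<chi> where "\<chi> x b = (- 1 :: int) ^ card (x \<inter> b)" for x b :: "'a set"
  have "int (card Z) * int (card B) ^ 2 = (\<Sum>x\<in>Z. (\<Sum>b\<in>B. \<chi> x b) ^ 2)"
    using orth by (simp add: \<chi>_def)
  also have "\<dots> \<le> (\<Sum>x\<in>Pow E. (\<Sum>b\<in>B. \<chi> x b) ^ 2)"
    by (rule sum_mono2) (use fin assms in auto)
  also have "\<dots> = (\<Sum>x\<in>Pow E. \<Sum>b\<in>B. \<Sum>b'\<in>B. \<chi> x b * \<chi> x b')"
    by (simp add: power2_eq_square sum_product)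
  also have "\<dots> = (\<Sum>b\<in>B. \<Sum>b'\<in>B. \<Sum>x\<in>Pow E. \<chi> x b * \<chi> x b')"
    by (subst sum.swap, rule sum.cong[OF refl], rule sum.swap)
  also have "\<dots> = (\<Sum>b\<in>B. \<Sum>b'\<in>B. if b = b' then 2 ^ card E else 0)"
    unfolding \<chi>_def using assms by (intro sum.cong refl sum_Pow_character) auto
  also have "\<dots> = int (card B) * 2 ^ card E" using fin by (simp add: sum.delta)
  finally have "int (card Z * card B * card B) \<le> int (2 ^ card E * card B)"
    by (simp add: power2_eq_square mult_ac)
  then have "card Z * card B * card B \<le> 2 ^ card E * card B"
    by (simp only: of_nat_le_iff)
  moreover have "card B > 0" using False fin by (simp add: card_gt_0_iff)
  ultimately show ?thesis by (simp only: mult_le_cancel2)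
qed simp

section \<open>Coboundaries of dart colourings\<close>

lemma finite_darts: "finite (darts R)"
proof (rule finite_subset)
  show "darts R \<subseteq> (SIGMA v:{..<length R}. {..<length (R ! v)})" by (auto simp: darts_def)
qed auto

lemma dart_label_image: "dart_label R ` darts R = edge_labels R"
proof (intro subset_antisym subsetI)
  fix a assume "a \<in> edge_labels R"
  then obtain v k where "v < length R" "k < length (R ! v)" "a = R ! v ! k"
    by (auto simp: edge_labels_def in_set_conv_nth)
  then have "(v, k) \<in> darts R" "a = dart_label R (v, k)"
    by (simp_all add: darts_def dart_label_def)
  then show "a \<in> dart_label R ` darts R" by blast
next
  fix a assume "a \<in> dart_label R ` darts R"
  then obtain v k where "v < length R" "k < length (R ! v)" "a = R ! v ! k"
    by (auto simp: darts_def dart_label_def)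
  then show "a \<in> edge_labels R"
    unfolding edge_labels_def by (meson UN_I nth_mem)
qed

lemma card_darts_at: "card {d \<in> darts R. P d} = (\<Sum>v<length R. card {k. k < length (R ! v) \<and> P (v, k)})"
proof -
  have "{d \<in> darts R. P d} = (SIGMA v:{..<length R}. {k. k < length (R ! v) \<and> P (v, k)})"
    by (auto simp: darts_def)
  then show ?thesis by simp
qed

lemma count_list_concat_darts:
  "count_list (concat R) a = card {d \<in> darts R. dart_label R d = a}"
proof -
  have "count_list r a = card {k. k < length r \<and> r ! k = a}" for r
    unfolding count_list_eq_length_filter length_filter_conv_card
    by (rule arg_cong[where f = card]) auto
  then show ?thesis
    unfolding count_list_concat sum_list_sum_nth card_darts_at
    by (simp add: dart_label_def lessThan_atLeast0)
qed

text \<open>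
  The labels across which the colouring \<open>g\<close> changes. Every label has two darts, so the parity
  condition says that \<open>g\<close> takes different values at them (\<open>coboundary_iff\<close>). In this form the
  additivity modulo 2 needs no reference to the two darts.
\<close>

definition coboundary :: "'a list list \<Rightarrow> (nat \<times> nat \<Rightarrow> bool) \<Rightarrow> 'a set" where
  "coboundary R g = {l \<in> edge_labels R. odd (card {d \<in> darts R. dart_label R d = l \<and> g d})}"

lemma coboundary_xor:
  "l \<in> coboundary R (\<lambda>d. g d \<noteq> h d) \<longleftrightarrow> l \<in> edge_labels R \<and> (l \<in> coboundary R g \<longleftrightarrow> l \<notin> coboundary R h)"
proof -
  have "{d \<in> darts R. dart_label R d = l \<and> f d} = {d \<in> {d \<in> darts R. dart_label R d = l}. f d}" for f
    by auto
  then show ?thesis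
    using odd_card_filter_xor[of "{d \<in> darts R. dart_label R d = l}" g h]
    by (auto simp: coboundary_def finite_darts)
qed

definition label_adjacency :: "'a list list \<Rightarrow> ('a \<times> 'a) set" where
  "label_adjacency R = {(a, b). \<exists>r \<in> set R. a \<in> set r \<and> b \<in> set r}"

definition label_component :: "'a list list \<Rightarrow> 'a \<Rightarrow> 'a set" where
  "label_component R a = (label_adjacency R \<union> (label_adjacency R)\<inverse>)\<^sup>* `` {a}"

locale even_cycles =
  fixes R :: "'a list list"
  assumes twice: "a \<in> edge_labels R \<Longrightarrow> count_list (concat R) a = 2"
    and nonempty: "r \<in> set R \<Longrightarrow> r \<noteq> []"
    and even_length: "r \<in> set R \<Longrightarrow> even (length r)"
begin

lemma finite_edge_labels: "finite (edge_labels R)"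
  by (simp add: edge_labels_def)

lemma label_in: "d \<in> darts R \<Longrightarrow> dart_label R d \<in> edge_labels R"
  using dart_label_image[of R] by blast

lemma card_label_darts: "a \<in> edge_labels R \<Longrightarrow> card {d \<in> darts R. dart_label R d = a} = 2"
  using twice count_list_concat_darts by metis

lemma label_pair:
  assumes "d \<in> darts R"
  obtains d' where "d' \<in> darts R" "d' \<noteq> d" "dart_label R d' = dart_label R d"
    "{e \<in> darts R. dart_label R e = dart_label R d} = {d, d'}"
proof -
  have "card {e \<in> darts R. dart_label R e = dart_label R d} = 2"
    using assms by (intro card_label_darts label_in)
  then obtain x y where xy: "{e \<in> darts R. dart_label R e = dart_label R d} = {x, y}" "x \<noteq> y"
    by (auto simp: card_2_iff)
  have "d \<in> {x, y}" unfolding xy(1)[symmetric] using assms by simp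
  then obtain d' where d': "{x, y} = {d, d'}" "d' \<noteq> d" using xy(2) by blast
  have "d' \<in> {e \<in> darts R. dart_label R e = dart_label R d}" unfolding xy(1) d'(1) by simp
  then have "d' \<in> darts R" "dart_label R d' = dart_label R d" by simp_all
  with that[of d'] xy(1) d' show thesis by simp
qed

lemma coboundary_iff:
  assumes "d \<in> darts R" "d' \<in> darts R" "d' \<noteq> d" "dart_label R d' = dart_label R d"
  shows "dart_label R d \<in> coboundary R g \<longleftrightarrow> g d \<noteq> g d'"
proof -
  obtain e where e: "{e \<in> darts R. dart_label R e = dart_label R d} = {d, e}"
    using label_pair[OF assms(1)] by metis
  moreover have "d' \<in> {d, e}" unfolding e[symmetric] using assms by simp
  ultimately have "{e \<in> darts R. dart_label R e = dart_label R d} = {d, d'}" using assms(3) by simp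
  then have "{e \<in> darts R. dart_label R e = dart_label R d \<and> g e} = {e \<in> {d, d'}. g e}"
    by blast
  also have "\<dots> = (if g d then {d} else {}) \<union> (if g d' then {d'} else {})" by auto
  finally show ?thesis using assms(3) label_in[OF assms(1)] by (simp add: coboundary_def)
qed

lemma coboundary_empty_iff:
  "coboundary R g = {} \<longleftrightarrow>
    (\<forall>d \<in> darts R. \<forall>d' \<in> darts R. dart_label R d = dart_label R d' \<longrightarrow> g d = g d')"
proof
  assume "coboundary R g = {}"
  then show "\<forall>d \<in> darts R. \<forall>d' \<in> darts R. dart_label R d = dart_label R d' \<longrightarrow> g d = g d'"
    using coboundary_iff by (metis empty_iff)
next
  assume r: "\<forall>d \<in> darts R. \<forall>d' \<in> darts R. dart_label R d = dart_label R d' \<longrightarrow> g d = g d'"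
  show "coboundary R g = {}"
  proof (rule ccontr)
    assume "coboundary R g \<noteq> {}"
    then obtain l where l: "l \<in> coboundary R g" by blast
    then have "l \<in> dart_label R ` darts R" by (simp add: coboundary_def dart_label_image)
    then obtain d where d: "d \<in> darts R" "l = dart_label R d" by blast
    then obtain d' where d': "d' \<in> darts R" "d' \<noteq> d" "dart_label R d' = dart_label R d"
      using label_pair by metis
    then show False using r l d coboundary_iff by metis
  qed
qed

text \<open>
  A step between adjacent labels passes from one dart to another at a common vertex, and both darts
  of a label have the same value.
\<close>

lemma constant_on_component:
  assumes "\<And>d d'. d \<in> darts R \<Longrightarrow> d' \<in> darts R \<Longrightarrow> dart_label R d = dart_label R d' \<Longrightarrow> g d = g d'"
    and "\<And>d d'. d \<in> darts R \<Longrightarrow> d' \<in> darts R \<Longrightarrow> fst d = fst d' \<Longrightarrow> g d = g d'"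
    and "d \<in> darts R" "d' \<in> darts R"
    and "label_component R (dart_label R d) = label_component R (dart_label R d')"
  shows "g d = g d'"
proof -
  define r where "r = label_adjacency R \<union> (label_adjacency R)\<inverse>"
  have step: "\<forall>e' \<in> darts R. dart_label R e' = b \<longrightarrow> g d = g e'"
    if "(dart_label R d, b) \<in> r\<^sup>*" for b
    using that
  proof (induction rule: rtrancl_induct)
    case base
    show ?case using assms(1)[OF assms(3)] by simp
  next
    case (step b c)
    obtain q where q: "q \<in> set R" "b \<in> set q" "c \<in> set q"
      using step.hyps by (auto simp: r_def label_adjacency_def)
    obtain v where v: "v < length R" "R ! v = q" using q by (auto simp: in_set_conv_nth)
    obtain k m where km: "k < length q" "q ! k = b" "m < length q" "q ! m = c"
      using q by (auto simp: in_set_conv_nth)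
    have *: "(v, k) \<in> darts R" "(v, m) \<in> darts R" "dart_label R (v, k) = b" "dart_label R (v, m) = c"
      using v km by (auto simp: darts_def dart_label_def)
    then have "g d = g (v, k)" using step.IH by simp
    also have "\<dots> = g (v, m)" using * by (intro assms(2)) auto
    finally show ?case using assms(1)[OF *(2)] *(4) by simp
  qed
  have "dart_label R d' \<in> label_component R (dart_label R d')" by (simp add: label_component_def)
  then have "(dart_label R d, dart_label R d') \<in> r\<^sup>*"
    unfolding assms(5)[symmetric] by (simp add: label_component_def r_def)
  then show ?thesis using step assms(4) by simp
qed

text \<open>
  Rank and nullity, where \<open>\<kappa>\<close> sends a dart to its vertex or to its face. If a colouring of
  \<open>K\<close> has empty coboundary, it is constant on the components of the diagram, so there are at most
  two to the number of components of such colourings. Each fibre of the coboundary map is a translate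
  of its kernel.
\<close>

lemma card_coboundary_image:
  fixes \<kappa> :: "nat \<times> nat \<Rightarrow> 'k"
  assumes K: "\<kappa> ` darts R = K"
    and kernel: "\<And>U d d'. coboundary R (\<lambda>d. \<kappa> d \<in> U) = {} \<Longrightarrow> d \<in> darts R \<Longrightarrow> d' \<in> darts R \<Longrightarrow>
      fst d = fst d' \<Longrightarrow> \<kappa> d \<in> U \<longleftrightarrow> \<kappa> d' \<in> U"
  shows "2 ^ card K \<le> card ((\<lambda>U. coboundary R (\<lambda>d. \<kappa> d \<in> U)) ` Pow K) *
    2 ^ card (label_component R ` edge_labels R)"
proof -
  define \<delta> where "\<delta> U = coboundary R (\<lambda>d. \<kappa> d \<in> U)" for U
  define base where "base b = (SOME U. U \<subseteq> K \<and> \<delta> U = b)" for b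
  define xor where "xor U V = (U - V) \<union> (V - U)" for U V :: "'k set"
  define comps where "comps W = (\<lambda>d. label_component R (dart_label R d)) ` {d \<in> darts R. \<kappa> d \<in> W}" for W
  have finK: "finite K" using K finite_darts by blast
  have base: "base (\<delta> U) \<subseteq> K \<and> \<delta> (base (\<delta> U)) = \<delta> U" if "U \<subseteq> K" for U
    unfolding base_def by (rule someI[of _ U]) (use that in auto)
  have xor_kernel: "\<delta> (xor U V) = {}" if "\<delta> U = \<delta> V" for U V
  proof -
    have "(\<lambda>d. \<kappa> d \<in> xor U V) = (\<lambda>d. (\<kappa> d \<in> U) \<noteq> (\<kappa> d \<in> V))" by (auto simp: xor_def fun_eq_iff)
    then show ?thesis using that coboundary_xor[of _ R "\<lambda>d. \<kappa> d \<in> U" "\<lambda>d. \<kappa> d \<in> V"]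
      by (auto simp: \<delta>_def)
  qed
  have comps_inj: "W \<subseteq> W'" if W: "\<delta> W = {}" "\<delta> W' = {}" "comps W = comps W'" "W \<subseteq> K" for W W'
  proof
    fix x assume x: "x \<in> W"
    then obtain d where d: "d \<in> darts R" "\<kappa> d = x" using K W by blast
    then have "label_component R (dart_label R d) \<in> comps W'" using x W(3) by (auto simp: comps_def)
    then obtain d' where d': "d' \<in> darts R" "\<kappa> d' \<in> W'"
      "label_component R (dart_label R d') = label_component R (dart_label R d)"
      by (auto simp: comps_def)
    have "(\<kappa> d' \<in> W') = (\<kappa> d \<in> W')"
    proof (rule constant_on_component)
      show "\<kappa> e \<in> W' \<longleftrightarrow> \<kappa> e' \<in> W'"
        if "e \<in> darts R" "e' \<in> darts R" "dart_label R e = dart_label R e'" for e e'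
        using W(2) that coboundary_empty_iff unfolding \<delta>_def by blast
      show "\<kappa> e \<in> W' \<longleftrightarrow> \<kappa> e' \<in> W'"
        if "e \<in> darts R" "e' \<in> darts R" "fst e = fst e'" for e e'
        using W(2) that kernel unfolding \<delta>_def by blast
    qed (use d d' in auto)
    then show "x \<in> W'" using d d' by simp
  qed
  \<comment> \<open>A set is determined by its image and by its difference, an element of the kernel, from a
    chosen representative of the fibre.\<close>
  have "inj_on (\<lambda>U. (\<delta> U, comps (xor U (base (\<delta> U))))) (Pow K)"
  proof (rule inj_onI)
    fix U V assume U: "U \<in> Pow K" and V: "V \<in> Pow K"
      and eq: "(\<delta> U, comps (xor U (base (\<delta> U)))) = (\<delta> V, comps (xor V (base (\<delta> V))))"
    define B where "B = base (\<delta> U)"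
    have B: "B \<subseteq> K" "\<delta> U = \<delta> B" "\<delta> V = \<delta> B" "comps (xor U B) = comps (xor V B)"
      using base[of U] U eq by (auto simp: B_def)
    have sub: "xor U B \<subseteq> K" "xor V B \<subseteq> K" using U V B by (auto simp: xor_def)
    have "xor U B = xor V B"
      using comps_inj[of "xor U B" "xor V B"] comps_inj[of "xor V B" "xor U B"] B xor_kernel sub by auto
    then show "U = V" by (auto simp: xor_def)
  qed
  then have "card (Pow K) \<le> card (\<delta> ` Pow K \<times> Pow (label_component R ` edge_labels R))"
  proof (rule card_inj_on_le)
    show "(\<lambda>U. (\<delta> U, comps (xor U (base (\<delta> U))))) ` Pow K
        \<subseteq> \<delta> ` Pow K \<times> Pow (label_component R ` edge_labels R)"
      using label_in by (auto simp: comps_def)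
  qed (use finK finite_edge_labels in auto)
  then show ?thesis using finK finite_edge_labels
    by (simp add: card_Pow card_cartesian_product \<delta>_def)
qed

end

section \<open>Checkerboard colourings of planar diagrams\<close>

definition alternating_coloring :: "'a list list \<Rightarrow> (nat \<times> nat \<Rightarrow> bool) \<Rightarrow> bool" where
  "alternating_coloring R c \<longleftrightarrow> (\<forall>d \<in> darts R. c (next_dart R d) \<noteq> c d \<and>
     (\<forall>d' \<in> darts R. d' \<noteq> d \<longrightarrow> dart_label R d' = dart_label R d \<longrightarrow> c d' \<noteq> c d))"

lemma alternating_coloringD:
  assumes "alternating_coloring R c"
  shows "d \<in> darts R \<Longrightarrow> c (next_dart R d) \<noteq> c d"
    and "d \<in> darts R \<Longrightarrow> d' \<in> darts R \<Longrightarrow> d' \<noteq> d \<Longrightarrow> dart_label R d' = dart_label R d \<Longrightarrow> c d' \<noteq> c d"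
  using assms unfolding alternating_coloring_def by blast+

context even_cycles
begin

lemma opposite_face_step:
  assumes "d \<in> darts R" "d' \<in> darts R" "d' \<noteq> d" "dart_label R d' = dart_label R d"
  shows "(d', next_dart R d) \<in> face_steps R"
  using assms unfolding face_steps_def by blast

text \<open>
  The region between two consecutive darts at \<open>v\<close> is a single face, so an edge at \<open>v\<close> lies in
  the coboundary exactly when the colour changes from the region on one side of it to the region on
  the other. Around the vertex the colour changes an even number of times.
\<close>

lemma coboundary_face_coloring_even:
  assumes g: "\<And>d d'. (d, d') \<in> face_steps R \<Longrightarrow> g d = g d'" and v: "v < length R"
  shows "even (card {k. k < length (R ! v) \<and> R ! v ! k \<in> coboundary R g})"
proof -
  have "R ! v ! k \<in> coboundary R g \<longleftrightarrow> g (v, k) \<noteq> g (v, Suc k mod length (R ! v))"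
    if "k < length (R ! v)" for k
  proof -
    have d: "(v, k) \<in> darts R" using v that by (simp add: darts_def)
    then obtain d' where d': "d' \<in> darts R" "d' \<noteq> (v, k)" "dart_label R d' = dart_label R (v, k)"
      using label_pair by metis
    then have "(d', next_dart R (v, k)) \<in> face_steps R" using d by (intro opposite_face_step)
    then have "g d' = g (v, Suc k mod length (R ! v))" using g by (simp add: next_dart_def)
    then show ?thesis using coboundary_iff[OF d d', of g] by (simp add: dart_label_def)
  qed
  then have "{k. k < length (R ! v) \<and> R ! v ! k \<in> coboundary R g} =
      {k. k < length (R ! v) \<and> g (v, k) \<noteq> g (v, Suc k mod length (R ! v))}"
    by blast
  then show ?thesis using even_card_cyclic_changes[of "length (R ! v)" "\<lambda>k. g (v, k)"] by simp
qed

text \<open>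
  The number of pairs of a label in \<open>S\<close> and a dart of it at a vertex in \<open>X\<close> is even, as it is
  a sum over the vertices in \<open>X\<close>. Modulo 2 only the labels with exactly one dart at \<open>X\<close> count.
\<close>

lemma even_card_Int_vertex_cut:
  assumes S: "S \<subseteq> edge_labels R"
    and even: "\<And>v. v < length R \<Longrightarrow> even (card {k. k < length (R ! v) \<and> R ! v ! k \<in> S})"
  shows "even (card (S \<inter> coboundary R (\<lambda>d. fst d \<in> X)))"
proof -
  define f where "f l = card {d \<in> darts R. dart_label R d = l \<and> fst d \<in> X}" for l
  have finS: "finite S" using S finite_edge_labels finite_subset by blast
  have "sum f S = card (\<Union>l\<in>S. {d \<in> darts R. dart_label R d = l \<and> fst d \<in> X})"
    unfolding f_def using finS by (subst card_UN_disjoint) (auto intro: finite_subset[OF _ finite_darts])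
  also have "(\<Union>l\<in>S. {d \<in> darts R. dart_label R d = l \<and> fst d \<in> X}) =
      {d \<in> darts R. dart_label R d \<in> S \<and> fst d \<in> X}"
    by blast
  also have "card \<dots> = (\<Sum>v<length R. card {k. k < length (R ! v) \<and> R ! v ! k \<in> S \<and> v \<in> X})"
    by (simp add: card_darts_at dart_label_def)
  also have "\<dots> = (\<Sum>v<length R. if v \<in> X then card {k. k < length (R ! v) \<and> R ! v ! k \<in> S} else 0)"
    by (rule sum.cong) auto
  finally have "even (sum f S)" using even by (auto intro!: dvd_sum)
  then have "even (card {l \<in> S. odd (f l)})" using even_sum_iff[OF finS] by blast
  moreover have "{l \<in> S. odd (f l)} = S \<inter> coboundary R (\<lambda>d. fst d \<in> X)"
    using S by (auto simp: coboundary_def f_def)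
  ultimately show ?thesis by simp
qed

text \<open>
  A dart stands for one fixed side of its edge, and the opposite dart for the other side.
\<close>

definition face :: "nat \<times> nat \<Rightarrow> (nat \<times> nat) set" where
  "face d = (face_steps R \<union> (face_steps R)\<inverse>)\<^sup>* `` {d}"

lemma face_step_eq:
  assumes "(d, d') \<in> face_steps R"
  shows "face d = face d'"
proof -
  let ?r = "face_steps R \<union> (face_steps R)\<inverse>"
  have "(d, d') \<in> ?r\<^sup>*" "(d', d) \<in> ?r\<^sup>*" using assms by (auto intro: r_into_rtrancl)
  then show ?thesis unfolding face_def by (auto intro: rtrancl_trans)
qed

text \<open>
  By Euler's formula the bounds of \<open>card_coboundary_image\<close> for faces and for vertices multiply to
  the maximum permitted by \<open>card_orthogonal_families\<close>. If the set of all labels were not a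
  coboundary of a face colouring, adding the complements of all these coboundaries would double that
  family while keeping it orthogonal to the cuts.
\<close>

lemma planar_face_coloring:
  assumes planar: "planar_cycles R"
  obtains U where "coboundary R (\<lambda>d. face d \<in> U) = edge_labels R"
proof -
  define F where "F = face ` darts R"
  define V where "V = {..<length R}"
  define E where "E = edge_labels R"
  define C where "C = card (label_component R ` E)"
  define fcut where "fcut U = coboundary R (\<lambda>d. face d \<in> U)" for U
  define vcut where "vcut X = coboundary R (\<lambda>d. fst d \<in> X)" for X
  have finE: "finite E" by (simp add: E_def finite_edge_labels)
  have finF: "finite F" by (simp add: F_def finite_darts)
  have "darts R // (face_steps R \<union> (face_steps R)\<inverse>)\<^sup>* = F"
    by (auto simp: quotient_def F_def face_def)
  moreover have "E // (label_adjacency R \<union> (label_adjacency R)\<inverse>)\<^sup>* = label_component R ` E"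
    by (auto simp: quotient_def label_component_def)
  ultimately have "int (card V) - int (card E) + int (card F) = 2 * int C"
    using planar by (simp add: planar_cycles_def num_components_def label_adjacency_def V_def E_def C_def)
  then have euler: "card V + card F = card E + 2 * C" by linarith
  have rank_V: "2 ^ card V \<le> card (vcut ` Pow V) * 2 ^ C"
    unfolding vcut_def C_def E_def
  proof (rule card_coboundary_image)
    show "fst ` darts R = V"
    proof
      show "V \<subseteq> fst ` darts R"
      proof
        fix v assume v: "v \<in> V"
        then have "R ! v \<noteq> []" using nonempty by (simp add: V_def)
        then have "(v, 0) \<in> darts R" using v by (simp add: V_def darts_def)
        then show "v \<in> fst ` darts R" by force
      qed
    qed (auto simp: V_def darts_def)
  qed auto
  have rank_F: "2 ^ card F \<le> card (fcut ` Pow F) * 2 ^ C"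
    unfolding fcut_def C_def E_def
  proof (rule card_coboundary_image)
    show "face ` darts R = F" by (simp add: F_def)
    fix U d d'
    assume ker: "coboundary R (\<lambda>d. face d \<in> U) = {}" and d: "d \<in> darts R" "d' \<in> darts R"
      and same: "fst d = fst d'"
    have next_eq: "face (next_dart R e) \<in> U \<longleftrightarrow> face e \<in> U" if e: "e \<in> darts R" for e
    proof -
      obtain e' where e': "e' \<in> darts R" "e' \<noteq> e" "dart_label R e' = dart_label R e"
        using label_pair e by metis
      then have "(e', next_dart R e) \<in> face_steps R" using e by (intro opposite_face_step)
      then have "face e' = face (next_dart R e)" by (rule face_step_eq)
      moreover have "face e' \<in> U \<longleftrightarrow> face e \<in> U"
        using ker e e' unfolding coboundary_empty_iff by blast
      ultimately show ?thesis by simp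
    qed
    have "face (fst d, k) \<in> U \<longleftrightarrow> face (fst d, 0) \<in> U" if "k < length (R ! fst d)" for k
      using that
    proof (induction k)
      case (Suc k)
      then show ?case using next_eq[of "(fst d, k)"] d by (auto simp: darts_def next_dart_def)
    qed simp
    from this[of "snd d"] this[of "snd d'"] show "face d \<in> U \<longleftrightarrow> face d' \<in> U"
      using d same by (auto simp: darts_def)
  qed
  have fcut_sub: "fcut U \<subseteq> E" and vcut_sub: "vcut X \<subseteq> E" for U X
    by (auto simp: fcut_def vcut_def coboundary_def E_def)
  have fcut_even: "even (card {k. k < length (R ! v) \<and> R ! v ! k \<in> fcut U})" if "v < length R" for v U
    unfolding fcut_def by (rule coboundary_face_coloring_even) (use that face_step_eq in auto)
  have co_even: "even (card {k. k < length (R ! v) \<and> R ! v ! k \<in> E - fcut U})" if v: "v < length R" for v U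
  proof -
    have "R ! v ! k \<in> E" if "k < length (R ! v)" for k
      using v that unfolding E_def edge_labels_def by (meson UN_I nth_mem)
    then have "{k. k < length (R ! v) \<and> R ! v ! k \<in> E - fcut U} =
        {..<length (R ! v)} - {k. k < length (R ! v) \<and> R ! v ! k \<in> fcut U}"
      by auto
    moreover have "card ({..<length (R ! v)} - {k. k < length (R ! v) \<and> R ! v ! k \<in> fcut U}) =
        length (R ! v) - card {k. k < length (R ! v) \<and> R ! v ! k \<in> fcut U}"
      by (subst card_Diff_subset) auto
    moreover have "even (length (R ! v))" using v by (simp add: even_length)
    ultimately show ?thesis using fcut_even[OF v] by simp
  qed
  have fcut_xor: "fcut ((U - U') \<union> (U' - U)) = (fcut U - fcut U') \<union> (fcut U' - fcut U)" for U U'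
  proof -
    have "(\<lambda>d. face d \<in> (U - U') \<union> (U' - U)) = (\<lambda>d. (face d \<in> U) \<noteq> (face d \<in> U'))" by auto
    then show ?thesis
      using coboundary_xor[of _ R "\<lambda>d. face d \<in> U" "\<lambda>d. face d \<in> U'"]
      by (auto simp: fcut_def coboundary_def)
  qed
  have "\<exists>U \<in> Pow F. fcut U = E"
  proof (rule ccontr)
    assume no: "\<not> (\<exists>U \<in> Pow F. fcut U = E)"
    \<comment> \<open>The complements are orthogonal to the cuts because all degrees are even.\<close>
    define B where "B = fcut ` Pow F"
    define Z where "Z = B \<union> (\<lambda>b. E - b) ` B"
    have "B \<inter> (\<lambda>b. E - b) ` B = {}"
    proof (rule ccontr)
      assume "B \<inter> (\<lambda>b. E - b) ` B \<noteq> {}"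
      then obtain U U' where U: "U \<subseteq> F" "U' \<subseteq> F" "fcut U = E - fcut U'" by (auto simp: B_def)
      then have "fcut ((U - U') \<union> (U' - U)) = E" using fcut_xor[of U U'] fcut_sub[of U'] by auto
      moreover have "(U - U') \<union> (U' - U) \<in> Pow F" using U by auto
      ultimately show False using no by blast
    qed
    moreover have "card ((\<lambda>b. E - b) ` B) = card B"
      by (rule card_image, rule inj_onI) (use fcut_sub in \<open>auto simp: B_def\<close>)
    ultimately have cardZ: "card Z = 2 * card B"
      using finF by (simp add: Z_def card_Un_disjoint B_def)
    have "card Z * card (vcut ` Pow V) \<le> 2 ^ card E"
    proof (rule card_orthogonal_families[OF finE])
      fix z b assume z: "z \<in> Z" and b: "b \<in> vcut ` Pow V"
      have "z \<subseteq> edge_labels R" using z fcut_sub by (auto simp: Z_def B_def E_def)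
      moreover have "even (card {k. k < length (R ! v) \<and> R ! v ! k \<in> z})" if "v < length R" for v
        using z fcut_even[OF that] co_even[OF that] by (auto simp: Z_def B_def)
      ultimately show "even (card (z \<inter> b))"
        using b even_card_Int_vertex_cut by (auto simp: vcut_def)
    qed (use fcut_sub vcut_sub in \<open>auto simp: Z_def B_def\<close>)
    moreover have "2 ^ (card V + card F) \<le> card B * card (vcut ` Pow V) * 2 ^ (2 * C)"
      using mult_le_mono[OF rank_V rank_F]
      unfolding B_def power_add mult_2 by (simp only: mult_ac)
    ultimately have "2 * 2 ^ (card V + card F) \<le> card Z * card (vcut ` Pow V) * 2 ^ (2 * C)"
      unfolding cardZ by simp
    also have "\<dots> \<le> 2 ^ card E * 2 ^ (2 * C)"
      using \<open>card Z * card (vcut ` Pow V) \<le> 2 ^ card E\<close> by (rule mult_le_mono1)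
    finally have "2 * 2 ^ (card V + card F) \<le> (2 ^ card E * 2 ^ (2 * C) :: nat)" .
    then show False unfolding euler by (simp add: power_add)
  qed
  then obtain U where "fcut U = E" by blast
  then show thesis using that[of U] by (simp add: fcut_def E_def)
qed

text \<open>
  Opposite darts of an edge lie in faces of different colours. The dart next to \<open>d\<close> has the face
  of the dart opposite to \<open>d\<close>, so its colour also differs from that of \<open>d\<close>.
\<close>

lemma planar_alternating_coloring:
  assumes "planar_cycles R"
  obtains c where "alternating_coloring R c"
proof -
  obtain U where U: "coboundary R (\<lambda>d. face d \<in> U) = edge_labels R"
    using planar_face_coloring[OF assms] .
  have opp: "(face d' \<in> U) \<noteq> (face d \<in> U)"
    if "d \<in> darts R" "d' \<in> darts R" "d' \<noteq> d" "dart_label R d' = dart_label R d" for d d'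
    using coboundary_iff[OF that, of "\<lambda>d. face d \<in> U"] label_in[OF that(1)] U by auto
  have "(face (next_dart R d) \<in> U) \<noteq> (face d \<in> U)" if d: "d \<in> darts R" for d
  proof -
    obtain d' where d': "d' \<in> darts R" "d' \<noteq> d" "dart_label R d' = dart_label R d"
      using label_pair d by metis
    then have "(d', next_dart R d) \<in> face_steps R" using d by (intro opposite_face_step)
    then have "face d' = face (next_dart R d)" by (rule face_step_eq)
    then show ?thesis using opp[OF d d'] by simp
  qed
  then have "alternating_coloring R (\<lambda>d. face d \<in> U)"
    using opp unfolding alternating_coloring_def by blast
  then show thesis by (rule that)
qed

end

section \<open>States join neighbouring outer ends\<close>

text \<open>
  Connectivity of arcs is expressed by the predicates that are constant along every arc. This makes
  gluing easy: invariance under a union of sets of arcs is a conjunction, and predicates on disjoint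
  sets of labels can be chosen independently.
\<close>

definition arc_invariant :: "('a \<times> 'a) set \<Rightarrow> ('a \<Rightarrow> bool) \<Rightarrow> bool" where
  "arc_invariant W P \<longleftrightarrow> (\<forall>(x, y) \<in> W. P x = P y)"

text \<open>
  Reflection in the diagonal through NW and SE. It exchanges horizontal with vertical sums and the
  numerator with the denominator closure.
\<close>

definition transpose_quad :: "'a quad \<Rightarrow> 'a quad" where
  "transpose_quad q = Quad (NW q) (SW q) (NE q) (SE q)"

lemma transpose_quad_simps [simp]:
  "NW (transpose_quad q) = NW q" "NE (transpose_quad q) = SW q"
  "SW (transpose_quad q) = NE q" "SE (transpose_quad q) = SE q"
  "transpose_quad (transpose_quad q) = q"
  by (simp_all add: transpose_quad_def)

text \<open>
  The paths that start at NW and SW end at NE and SE and lie in different components: connected ends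
  cannot be separated by an invariant predicate, and ends in different components are separated by
  some.
\<close>

definition joins_horizontally :: "('a \<times> 'a) set \<Rightarrow> 'a quad \<Rightarrow> bool" where
  "joins_horizontally W q \<longleftrightarrow>
     (\<forall>P. arc_invariant W P \<longrightarrow> P (NW q) = P (NE q) \<and> P (SW q) = P (SE q)) \<and>
     (\<exists>P. arc_invariant W P \<and> P (NW q) \<and> \<not> P (SW q))"

abbreviation joins_vertically :: "('a \<times> 'a) set \<Rightarrow> 'a quad \<Rightarrow> bool" where
  "joins_vertically W q \<equiv> joins_horizontally W (transpose_quad q)"

lemma arc_invariant_rtrancl:
  assumes "arc_invariant W P" "(x, y) \<in> W\<^sup>*"
  shows "P x = P y"
  using assms(2)
  by (induction rule: rtrancl_induct) (use assms(1) in \<open>auto simp: arc_invariant_def\<close>)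

text \<open>
  The arcs form a partial permutation of \<open>E\<close> that starts at \<open>p\<close> and \<open>p'\<close> and stops at
  \<open>s\<close> and \<open>s'\<close>. The forward orbit of a source is a whole component, as there is no way to enter
  it from outside. It is a chain, so it contains at most one sink, and a finite chain has an end.
\<close>

lemma path_from_source:
  assumes fin: "finite E" and sv: "single_valued r" "single_valued (r\<inverse>)"
    and dom: "Domain r = E - {s, s'}" and ran: "Range r = E - {p, p'}"
    and ne: "s \<noteq> s'" "p \<noteq> p'" and mem: "p \<in> E"
  shows "arc_invariant r (\<lambda>x. (p, x) \<in> r\<^sup>*)"
    and "(p, p') \<notin> r\<^sup>*"
    and "(p, s) \<in> r\<^sup>* \<longleftrightarrow> (p, s') \<notin> r\<^sup>*"
proof -
  have not_ran: "(z, p) \<notin> r" "(z, p') \<notin> r" for z using ran by auto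
  have backward: "(p, x) \<in> r\<^sup>*" if "(p, y) \<in> r\<^sup>*" "(x, y) \<in> r" for x y
    using that(1)
  proof (cases rule: rtranclE)
    case base
    then show ?thesis using that(2) not_ran by simp
  next
    case (step z)
    then have "z = x" using that(2) sv(2) by (auto simp: single_valued_def)
    then show ?thesis using step by simp
  qed
  then show "arc_invariant r (\<lambda>x. (p, x) \<in> r\<^sup>*)"
    by (auto simp: arc_invariant_def intro: rtrancl_into_rtrancl)
  show p': "(p, p') \<notin> r\<^sup>*"
    using ne not_ran by (auto elim: rtranclE)
  have "s \<notin> Domain r" "s' \<notin> Domain r" using dom by auto
  then have stuck: "(s, x) \<in> r\<^sup>* \<Longrightarrow> x = s" "(s', x) \<in> r\<^sup>* \<Longrightarrow> x = s'" for x
    by (auto elim: converse_rtranclE)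
  have not_both: "\<not> ((p, s) \<in> r\<^sup>* \<and> (p, s') \<in> r\<^sup>*)"
    using single_valued_confluent[OF sv(1)] stuck ne by metis
  have "(p, s) \<in> r\<^sup>* \<or> (p, s') \<in> r\<^sup>*"
  proof (rule ccontr)
    assume none: "\<not> ((p, s) \<in> r\<^sup>* \<or> (p, s') \<in> r\<^sup>*)"
    \<comment> \<open>Without a sink in \<open>K\<close>, the arcs would map \<open>K\<close> injectively onto \<open>K - {p}\<close>.\<close>
    define K where "K = {x. (p, x) \<in> r\<^sup>*}"
    define t where "t = r \<inter> K \<times> K"
    have "x \<in> E" if "x \<in> K" for x
    proof -
      have "(p, x) \<in> r\<^sup>*" using that by (simp add: K_def)
      then show ?thesis by (cases rule: rtranclE) (use mem ran in auto)
    qed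
    then have KE: "K \<subseteq> E" by blast
    then have finK: "finite K" using fin finite_subset by blast
    have closed: "y \<in> K \<longleftrightarrow> x \<in> K" if "(x, y) \<in> r" for x y
      using that backward by (auto simp: K_def intro: rtrancl_into_rtrancl)
    have "Domain t = K \<inter> Domain r" "Range t = K \<inter> Range r"
      using closed by (auto simp: t_def)
    then have "Domain t = K" "Range t = K - {p}"
      using none p' KE dom ran by (auto simp: K_def)
    moreover have "card (Domain t) = card t"
      unfolding Domain_fst by (rule card_image)
        (use sv(1) in \<open>auto simp: t_def inj_on_def single_valued_def\<close>)
    moreover have "card (Range t) = card t"
      unfolding Range_snd by (rule card_image)
        (use sv(2) in \<open>auto simp: t_def inj_on_def single_valued_def\<close>)
    moreover have "p \<in> K" by (simp add: K_def)
    ultimately show False using finK card_Diff1_less[of K p] by simp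
  qed
  then show "(p, s) \<in> r\<^sup>* \<longleftrightarrow> (p, s') \<notin> r\<^sup>*" using not_both by blast
qed

text \<open>
  The two sources NW and SE lead to different sinks: the arcs can be followed backwards from a sink in
  only one way.
\<close>

lemma partial_permutation_joins:
  assumes fin: "finite E" and sv: "single_valued r" "single_valued (r\<inverse>)"
    and dom: "Domain r = E - {NE q, SW q}" and ran: "Range r = E - {NW q, SE q}"
    and ne: "NE q \<noteq> SW q" "NW q \<noteq> SE q" and mem: "NW q \<in> E" "SE q \<in> E"
  shows "joins_horizontally r q \<or> joins_vertically r q"
proof -
  note nw = path_from_source[OF fin sv dom ran ne mem(1)]
  note se = path_from_source[OF fin sv dom ran[unfolded insert_commute[of "NW q"]] ne(1)
      not_sym[OF ne(2)] mem(2)]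
  have disjoint: "\<not> ((NW q, x) \<in> r\<^sup>* \<and> (SE q, x) \<in> r\<^sup>*)" for x
  proof
    assume "(NW q, x) \<in> r\<^sup>* \<and> (SE q, x) \<in> r\<^sup>*"
    then have "(x, NW q) \<in> (r\<inverse>)\<^sup>*" "(x, SE q) \<in> (r\<inverse>)\<^sup>*" by (simp_all add: rtrancl_converse)
    then have "(NW q, SE q) \<in> (r\<inverse>)\<^sup>* \<or> (SE q, NW q) \<in> (r\<inverse>)\<^sup>*"
      by (rule single_valued_confluent[OF sv(2)])
    then show False using nw(2) se(2) by (auto simp: rtrancl_converse)
  qed
  have sep: "\<exists>P. arc_invariant r P \<and> P (NW q) \<and> \<not> P (SE q)"
    using nw(1,2) by (intro exI[of _ "\<lambda>x. (NW q, x) \<in> r\<^sup>*"]) simp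
  consider "(NW q, NE q) \<in> r\<^sup>*" "(SE q, SW q) \<in> r\<^sup>*" | "(NW q, SW q) \<in> r\<^sup>*" "(SE q, NE q) \<in> r\<^sup>*"
    using nw(3) se(3) disjoint by blast
  then show ?thesis
  proof cases
    case 1
    then have "arc_invariant r P \<Longrightarrow> P (NW q) = P (NE q) \<and> P (SE q) = P (SW q)" for P
      using arc_invariant_rtrancl by metis
    then show ?thesis using sep by (auto simp: joins_horizontally_def)
  next
    case 2
    then have "arc_invariant r P \<Longrightarrow> P (NW q) = P (SW q) \<and> P (SE q) = P (NE q)" for P
      using arc_invariant_rtrancl by metis
    then show ?thesis using sep by (auto simp: joins_horizontally_def)
  qed
qed

text \<open>
  A smoothing of a vertex with \<open>n = 4\<close> darts pairs neighbouring darts: 0 with 1 and 2 with 3 for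
  \<open>True\<close>, and 0 with 3 and 1 with 2 for \<open>False\<close>. At a bivalent vertex, \<open>n = 2\<close>, both choices pair the two
  darts. A dart and its partner have positions of different parity, which is what makes smoothings
  compatible with alternating colourings.
\<close>

definition partner :: "bool \<Rightarrow> nat \<Rightarrow> nat \<Rightarrow> nat" where
  "partner t n k = (if t then if even k then Suc k else k - 1 else n - 1 - k)"

lemma partner_props:
  assumes "even n" "k < n"
  shows "partner t n k < n" "even (partner t n k) \<longleftrightarrow> odd k" "partner t n (partner t n k) = k"
proof -
  have "Suc k < n" if "even k" using assms that by presburger
  then show "partner t n k < n" using assms by (auto simp: partner_def)
  show "even (partner t n k) \<longleftrightarrow> odd k" using assms by (auto simp: partner_def)
  show "partner t n (partner t n k) = k" using assms by (auto simp: partner_def odd_pos)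
qed

definition smoothing_invariant :: "bool \<Rightarrow> 'a list \<Rightarrow> ('a \<Rightarrow> bool) \<Rightarrow> bool" where
  "smoothing_invariant t r P \<longleftrightarrow> (\<forall>k < length r. P (r ! k) = P (r ! partner t (length r) k))"

text \<open>
  Direct every arc of the smoothed diagram from the dart with the colour of the outer NE end to the
  dart of the other colour. Every label has exactly one dart of either colour, so this is a partial
  permutation of the labels. Of the outer labels, NE and SW have their dart of the first colour at the
  outer vertex, where there are no arcs, and NW and SE have there their dart of the second colour.
\<close>

lemma (in even_cycles) smoothing_joins:
  assumes planar: "planar_cycles R" and R: "R = R\<^sub>0 @ [outer_cycle q]"
    and W: "\<And>P. arc_invariant W P \<longleftrightarrow> (\<forall>v < length R\<^sub>0. smoothing_invariant (t v) (R\<^sub>0 ! v) P)"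
  shows "joins_horizontally W q \<or> joins_vertically W q"
proof -
  obtain c where c: "alternating_coloring R c"
    using planar_alternating_coloring[OF planar] .
  define v\<^sub>0 where "v\<^sub>0 = length R\<^sub>0"
  define s where "s d \<longleftrightarrow> c d = c (v\<^sub>0, 0)" for d
  define lab where "lab = dart_label R"
  define D where "D = darts R"
  define D\<^sub>0 where "D\<^sub>0 = {d \<in> D. fst d < v\<^sub>0}"
  define m where "m d = (fst d, partner (t (fst d)) (length (R ! fst d)) (snd d))" for d
  define r where "r = {(lab d, lab (m d)) |d. d \<in> D\<^sub>0 \<and> s d}"
  have s_opp: "s d' \<noteq> s d" if "d \<in> D" "d' \<in> D" "d' \<noteq> d" "lab d' = lab d" for d d'
    using alternating_coloringD(2)[OF c, of d d'] that unfolding s_def D_def lab_def by blast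
  have alt: "s (v, k) \<longleftrightarrow> (s (v, 0) \<longleftrightarrow> even k)" if "v < length R" "k < length (R ! v)" for v k
    using that(2)
  proof (induction k)
    case (Suc k)
    then have "(v, k) \<in> darts R" using that(1) by (simp add: darts_def)
    then show ?case using Suc alternating_coloringD(1)[OF c, of "(v, k)"] by (auto simp: s_def next_dart_def)
  qed simp
  have m: "m d \<in> D\<^sub>0" "s (m d) \<noteq> s d" "m (m d) = d" if "d \<in> D\<^sub>0" for d
  proof -
    obtain v k where d: "d = (v, k)" by force
    have "v < v\<^sub>0" "v < length R" "k < length (R ! v)"
      using that d by (simp_all add: D\<^sub>0_def D_def darts_def)
    then have v: "v < v\<^sub>0" "v < length R" "k < length (R ! v)" "even (length (R ! v))"
      by (simp_all add: even_length)
    note p = partner_props[OF v(4,3), of "t v"]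
    show "m d \<in> D\<^sub>0" using v p d by (auto simp: D\<^sub>0_def D_def darts_def m_def)
    show "s (m d) \<noteq> s d" using alt[OF v(2,3)] alt[OF v(2) p(1)] p(2) by (simp add: d m_def)
    show "m (m d) = d" using p(3) by (simp add: d m_def)
  qed
  have inj_b: "inj_on lab {d \<in> D. s d = b}" for b
  proof (rule inj_onI)
    fix d e assume "d \<in> {d \<in> D. s d = b}" "e \<in> {d \<in> D. s d = b}" "lab d = lab e"
    then show "d = e" using s_opp[of d e] by (cases "e = d") simp_all
  qed
  have inj: "inj_on lab {d \<in> D. s d}" "inj_on lab {d \<in> D. \<not> s d}"
    using inj_b[of True] inj_b[of False] by simp_all
  have onto: "lab ` {d \<in> D. s d = b} = edge_labels R" for b
  proof
    show "edge_labels R \<subseteq> lab ` {d \<in> D. s d = b}"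
    proof
      fix l assume "l \<in> edge_labels R"
      then have "l \<in> lab ` D" by (simp add: lab_def D_def dart_label_image)
      then obtain d where d: "d \<in> D" "l = lab d" by blast
      then obtain d' where d': "d' \<in> D" "d' \<noteq> d" "lab d' = lab d"
        using label_pair[of d] unfolding lab_def D_def by metis
      then have "s d' \<noteq> s d" using s_opp[of d d'] d by simp
      then consider "s d = b" | "s d' = b" by blast
      then show "l \<in> lab ` {d \<in> D. s d = b}"
      proof cases
        case 1
        then show ?thesis using d by simp
      next
        case 2
        then have "lab d' \<in> lab ` {d \<in> D. s d = b}" using d' by blast
        then show ?thesis using d(2) d'(3) by simp
      qed
    qed
  next
    show "lab ` {d \<in> D. s d = b} \<subseteq> edge_labels R"
      unfolding lab_def D_def dart_label_image[symmetric] by blast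
  qed
  have R_v0: "R ! v\<^sub>0 = [NE q, SE q, SW q, NW q]" "v\<^sub>0 < length R"
    by (simp_all add: R v\<^sub>0_def outer_cycle_def)
  have D_out: "D = D\<^sub>0 \<union> {(v\<^sub>0, 0), (v\<^sub>0, 1), (v\<^sub>0, 2), (v\<^sub>0, 3)}"
  proof -
    have len: "v < length R \<longleftrightarrow> v < v\<^sub>0 \<or> v = v\<^sub>0" for v by (auto simp: R v\<^sub>0_def)
    have out: "k < length (R ! v\<^sub>0) \<longleftrightarrow> k = 0 \<or> k = 1 \<or> k = 2 \<or> k = 3" for k
      by (auto simp: R_v0)
    have iff: "(v, k) \<in> D \<longleftrightarrow> (v, k) \<in> D\<^sub>0 \<or> v = v\<^sub>0 \<and> (k = 0 \<or> k = 1 \<or> k = 2 \<or> k = 3)" for v k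
    proof (cases "v = v\<^sub>0")
      case True
      then show ?thesis using R_v0(2) out[of k] by (simp add: D\<^sub>0_def D_def darts_def)
    next
      case False
      then show ?thesis using len[of v] unfolding D\<^sub>0_def D_def darts_def by simp blast
    qed
    show ?thesis
    proof (rule Set.set_eqI)
      fix d :: "nat \<times> nat"
      show "d \<in> D \<longleftrightarrow> d \<in> D\<^sub>0 \<union> {(v\<^sub>0, 0), (v\<^sub>0, 1), (v\<^sub>0, 2), (v\<^sub>0, 3)}"
        using iff[of "fst d" "snd d"] by (cases d) (simp, blast)
    qed
  qed
  have s_out: "s (v\<^sub>0, 0)" "\<not> s (v\<^sub>0, 1)" "s (v\<^sub>0, 2)" "\<not> s (v\<^sub>0, 3)"
    using alt[of v\<^sub>0 0] alt[of v\<^sub>0 1] alt[of v\<^sub>0 2] alt[of v\<^sub>0 3] by (simp_all add: R_v0 s_def)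
  have lab_out: "lab (v\<^sub>0, 0) = NE q" "lab (v\<^sub>0, 1) = SE q" "lab (v\<^sub>0, 2) = SW q" "lab (v\<^sub>0, 3) = NW q"
    by (simp_all add: lab_def dart_label_def R_v0)
  have out_D: "(v\<^sub>0, 0) \<in> D" "(v\<^sub>0, 1) \<in> D" "(v\<^sub>0, 2) \<in> D" "(v\<^sub>0, 3) \<in> D" using D_out by auto
  have not_D0: "(v\<^sub>0, k) \<notin> D\<^sub>0" for k by (simp add: D\<^sub>0_def)
  have pos: "{d \<in> D\<^sub>0. s d} = {d \<in> D. s d} - {(v\<^sub>0, 0), (v\<^sub>0, 2)}"
    and neg: "{d \<in> D\<^sub>0. \<not> s d} = {d \<in> D. \<not> s d} - {(v\<^sub>0, 1), (v\<^sub>0, 3)}"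
    using s_out not_D0 by (auto simp: D_out)
  have labpos: "lab ` {d \<in> D\<^sub>0. s d} = edge_labels R - {NE q, SW q}"
    unfolding pos using inj_on_image_set_diff[OF inj(1), of "{d \<in> D. s d}" "{(v\<^sub>0, 0), (v\<^sub>0, 2)}"]
      onto[of True] s_out out_D lab_out by auto
  have labneg: "lab ` {d \<in> D\<^sub>0. \<not> s d} = edge_labels R - {SE q, NW q}"
    unfolding neg using inj_on_image_set_diff[OF inj(2), of "{d \<in> D. \<not> s d}" "{(v\<^sub>0, 1), (v\<^sub>0, 3)}"]
      onto[of False] s_out out_D lab_out by auto
  have "m ` {d \<in> D\<^sub>0. s d} = {d \<in> D\<^sub>0. \<not> s d}"
  proof
    show "{d \<in> D\<^sub>0. \<not> s d} \<subseteq> m ` {d \<in> D\<^sub>0. s d}"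
    proof
      fix d assume "d \<in> {d \<in> D\<^sub>0. \<not> s d}"
      then have "m d \<in> {d \<in> D\<^sub>0. s d}" "d = m (m d)" using m[of d] by auto
      then show "d \<in> m ` {d \<in> D\<^sub>0. s d}" by blast
    qed
  qed (use m in auto)
  then have "lab ` m ` {d \<in> D\<^sub>0. s d} = edge_labels R - {NW q, SE q}" using labneg by auto
  moreover have "Range r = lab ` m ` {d \<in> D\<^sub>0. s d}" unfolding r_def by blast
  ultimately have ran: "Range r = edge_labels R - {NW q, SE q}" by simp
  have dom: "Domain r = edge_labels R - {NE q, SW q}"
    unfolding labpos[symmetric] r_def by blast
  have D0_D: "D\<^sub>0 \<subseteq> D" by (auto simp: D\<^sub>0_def)
  have sv: "single_valued r"
  proof (rule single_valuedI)
    fix x y z assume "(x, y) \<in> r" "(x, z) \<in> r"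
    then obtain d e where "d \<in> D\<^sub>0" "s d" "e \<in> D\<^sub>0" "s e" "lab d = lab e" "y = lab (m d)" "z = lab (m e)"
      by (auto simp: r_def)
    then show "y = z" using inj_onD[OF inj(1), of d e] D0_D by auto
  qed
  have sv': "single_valued (r\<inverse>)"
  proof (rule single_valuedI)
    fix x y z assume "(x, y) \<in> r\<inverse>" "(x, z) \<in> r\<inverse>"
    then obtain d e where de: "d \<in> D\<^sub>0" "s d" "e \<in> D\<^sub>0" "s e" "lab (m d) = lab (m e)" "y = lab d" "z = lab e"
      by (auto simp: r_def)
    then have "m d = m e" using inj_onD[OF inj(2), of "m d" "m e"] m[of d] m[of e] D0_D by auto
    then have "d = e" using m(3) de by metis
    then show "y = z" using de by simp
  qed
  have ne: "NE q \<noteq> SW q" "NW q \<noteq> SE q"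
    using inj_onD[OF inj(1), of "(v\<^sub>0, 0)" "(v\<^sub>0, 2)"] inj_onD[OF inj(2), of "(v\<^sub>0, 1)" "(v\<^sub>0, 3)"]
      s_out out_D lab_out by auto
  have mem: "NW q \<in> edge_labels R" "SE q \<in> edge_labels R"
    using label_in out_D lab_out unfolding lab_def D_def by metis+
  have "arc_invariant W P \<longleftrightarrow> arc_invariant r P" for P
  proof -
    have "(\<forall>v < length R\<^sub>0. smoothing_invariant (t v) (R\<^sub>0 ! v) P) \<longleftrightarrow> (\<forall>d \<in> D\<^sub>0. P (lab d) = P (lab (m d)))"
      by (auto simp: smoothing_invariant_def D\<^sub>0_def D_def darts_def lab_def dart_label_def m_def
          v\<^sub>0_def R nth_append)
    also have "\<dots> \<longleftrightarrow> (\<forall>d \<in> D\<^sub>0. s d \<longrightarrow> P (lab d) = P (lab (m d)))"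
      using m by metis
    also have "\<dots> \<longleftrightarrow> arc_invariant r P" by (auto simp: arc_invariant_def r_def)
    finally show ?thesis using W by simp
  qed
  moreover have "joins_horizontally r q \<or> joins_vertically r q"
    by (rule partial_permutation_joins[OF finite_edge_labels sv sv' dom ran ne mem])
  ultimately show ?thesis by (simp add: joins_horizontally_def)
qed

section \<open>Circles in closures and in glued states\<close>

lemma arc_invariant_simps [simp]:
  "arc_invariant {} P"
  "arc_invariant (insert a W) P \<longleftrightarrow> P (fst a) = P (snd a) \<and> arc_invariant W P"
  "arc_invariant (W \<union> W') P \<longleftrightarrow> arc_invariant W P \<and> arc_invariant W' P"
  by (auto simp: arc_invariant_def split: prod.splits)

lemma arc_invariant_image [simp]:
  "arc_invariant (map_prod f f ` W) P \<longleftrightarrow> arc_invariant W (P \<circ> f)"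
  by (auto simp: arc_invariant_def)

lemma arc_invariant_const: "arc_invariant W (\<lambda>_. b)"
  by (auto simp: arc_invariant_def)

definition connected_arcs :: "('a \<times> 'a) set \<Rightarrow> bool" where
  "connected_arcs W \<longleftrightarrow>
     (\<forall>P. arc_invariant W P \<longrightarrow> (\<forall>x \<in> Field W. \<forall>y \<in> Field W. P x = P y))"

text \<open>
  The positivity matters because the exponent of the loop value in the bracket is a truncated
  difference: it is 0 only when there is exactly one circle.
\<close>

lemma num_circles_eq_1_iff:
  assumes "arcs \<noteq> []"
  shows "num_circles arcs = 1 \<longleftrightarrow> connected_arcs (set arcs)" and "num_circles arcs > 0"
proof -
  define W where "W = set arcs"
  define r where "r = (W \<union> W\<inverse>)\<^sup>*"
  define S where "S = Field W"
  have S: "finite S" "S \<noteq> {}"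
    using assms by (simp_all add: S_def W_def finite_Field) (auto simp: Field_def neq_Nil_conv)
  have fld: "fst ` W \<union> snd ` W = Field W" by (simp add: Field_def Domain_fst Range_snd)
  have "S // r = (\<lambda>x. r `` {x}) ` S" by (auto simp: quotient_def)
  then have n: "num_circles arcs = card ((\<lambda>x. r `` {x}) ` S)"
    by (simp add: num_circles_def num_components_def fld r_def S_def flip: W_def)
  show "num_circles arcs > 0" unfolding n using S by (simp add: card_gt_0_iff)
  have sym: "(y, x) \<in> r" if "(x, y) \<in> r" for x y
    using that sym_rtrancl[of "W \<union> W\<inverse>"] by (auto simp: r_def sym_Un_converse symD)
  have "card ((\<lambda>x. r `` {x}) ` S) = 1 \<longleftrightarrow> (\<forall>x \<in> S. \<forall>y \<in> S. r `` {x} = r `` {y})"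
  proof
    assume "card ((\<lambda>x. r `` {x}) ` S) = 1"
    then obtain c where c: "(\<lambda>x. r `` {x}) ` S = {c}" by (auto simp: card_1_singleton_iff)
    have "r `` {x} = c" if "x \<in> S" for x
      using imageI[OF that, of "\<lambda>x. r `` {x}"] c by simp
    then show "\<forall>x \<in> S. \<forall>y \<in> S. r `` {x} = r `` {y}" by simp
  next
    assume *: "\<forall>x \<in> S. \<forall>y \<in> S. r `` {x} = r `` {y}"
    obtain x where x: "x \<in> S" using S by blast
    have "(\<lambda>y. r `` {y}) ` S = (\<lambda>_. r `` {x}) ` S"
      by (rule image_cong[OF refl]) (use * x in blast)
    then show "card ((\<lambda>x. r `` {x}) ` S) = 1" using S(2) by (simp add: image_constant_conv)
  qed
  also have "\<dots> \<longleftrightarrow> connected_arcs W"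
  proof
    assume *: "\<forall>x \<in> S. \<forall>y \<in> S. r `` {x} = r `` {y}"
    show "connected_arcs W" unfolding connected_arcs_def
    proof (intro allI impI ballI)
      fix P x y assume P: "arc_invariant W P" and xy: "x \<in> Field W" "y \<in> Field W"
      have "r `` {x} = r `` {y}" by (rule *[rule_format]) (use xy in \<open>simp_all add: S_def\<close>)
      moreover have "y \<in> r `` {y}" by (simp add: r_def)
      ultimately have "(x, y) \<in> r" by blast
      moreover have "arc_invariant (W \<union> W\<inverse>) P" using P by (auto simp: arc_invariant_def)
      ultimately show "P x = P y" using arc_invariant_rtrancl unfolding r_def by metis
    qed
  next
    assume c: "connected_arcs W"
    show "\<forall>x \<in> S. \<forall>y \<in> S. r `` {x} = r `` {y}"
    proof (intro ballI)
      fix x y assume xy: "x \<in> S" "y \<in> S"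
      have "arc_invariant W (\<lambda>z. (x, z) \<in> r)"
        by (auto simp: arc_invariant_def r_def intro: rtrancl_into_rtrancl)
      then have "(x, x) \<in> r \<longleftrightarrow> (x, y) \<in> r"
        using c xy unfolding connected_arcs_def S_def by blast
      then have "(x, y) \<in> r" by (simp add: r_def)
      moreover have "(y, x) \<in> r" using sym \<open>(x, y) \<in> r\<close> .
      ultimately show "r `` {x} = r `` {y}" unfolding r_def by (auto intro: rtrancl_trans)
    qed
  qed
  finally show "num_circles arcs = 1 \<longleftrightarrow> connected_arcs (set arcs)" by (simp add: n W_def)
qed

lemma joins_horizontallyE:
  assumes "joins_horizontally W q"
  shows "arc_invariant W P \<Longrightarrow> P (NW q) = P (NE q)" "arc_invariant W P \<Longrightarrow> P (SW q) = P (SE q)"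
    and "\<exists>P. arc_invariant W P \<and> P (NW q) \<and> P (NE q) \<and> \<not> P (SW q) \<and> \<not> P (SE q)"
  using assms unfolding joins_horizontally_def by blast+

lemma joins_verticallyE:
  assumes "joins_vertically W q"
  shows "arc_invariant W P \<Longrightarrow> P (NW q) = P (SW q)" "arc_invariant W P \<Longrightarrow> P (NE q) = P (SE q)"
    and "\<exists>P. arc_invariant W P \<and> P (NW q) \<and> P (SW q) \<and> \<not> P (NE q) \<and> \<not> P (SE q)"
  using joins_horizontallyE[OF assms] by simp_all

lemma not_joins_both: "joins_horizontally W q \<Longrightarrow> \<not> joins_vertically W q"
  using joins_horizontallyE(3) joins_verticallyE(1) by metis

text \<open>
  Every component of the state meets an outer end. Otherwise a predicate could be constant on the
  outer ends and take the other value on a closed component.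
\<close>

definition no_closed_component :: "('a \<times> 'a) set \<Rightarrow> 'a quad \<Rightarrow> bool" where
  "no_closed_component W q \<longleftrightarrow>
     (\<forall>P b. arc_invariant W P \<longrightarrow> (\<forall>x \<in> set_quad q. P x = b) \<longrightarrow> (\<forall>x \<in> Field W. P x = b))"

lemma no_closed_componentD:
  assumes "no_closed_component W q" "arc_invariant W P" "\<forall>x \<in> set_quad q. P x = b"
    and "x \<in> Field W \<union> set_quad q"
  shows "P x = b"
  using assms(4) assms(1)[unfolded no_closed_component_def, rule_format, OF assms(2)] assms(3) by blast

lemma set_quad_eq: "set_quad q = {NW q, NE q, SW q, SE q}"
  by (cases q) auto

lemma no_closed_component_transpose [simp]:
  "no_closed_component W (transpose_quad q) = no_closed_component W q"
  by (simp add: no_closed_component_def set_quad_eq insert_commute)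

lemma closure_arcs_transpose:
  "closure_arcs 1 (transpose_quad q) = closure_arcs 2 q"
  "closure_arcs 2 (transpose_quad q) = closure_arcs 1 q"
  by (simp_all add: closure_arcs_def)

text \<open>
  The numerator closure joins NW to NE and SW to SE. A horizontal state then falls into at least two
  circles, and in a vertical one the two paths are linked to a single circle.
\<close>

lemma connected_numerator_closure:
  assumes "joins_horizontally W q \<or> joins_vertically W q"
  shows "connected_arcs (W \<union> set (closure_arcs 1 q)) \<longleftrightarrow>
    joins_vertically W q \<and> no_closed_component W q" (is "?L \<longleftrightarrow> ?R")
proof -
  have F: "Field (W \<union> set (closure_arcs 1 q)) = Field W \<union> set_quad q"
    by (auto simp: closure_arcs_def set_quad_eq Field_def)
  have inv: "arc_invariant (W \<union> set (closure_arcs 1 q)) P \<longleftrightarrow>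
      arc_invariant W P \<and> P (NW q) = P (NE q) \<and> P (SW q) = P (SE q)" for P
    by (simp add: closure_arcs_def conj_ac)
  have conn: "?L \<longleftrightarrow> (\<forall>P. arc_invariant W P \<longrightarrow> P (NW q) = P (NE q) \<longrightarrow> P (SW q) = P (SE q) \<longrightarrow>
      (\<forall>x \<in> Field W \<union> set_quad q. \<forall>y \<in> Field W \<union> set_quad q. P x = P y))"
    unfolding connected_arcs_def F inv by (simp only: imp_conjL)
  show ?thesis
  proof
    assume ?L
    note L = this[unfolded conn, rule_format]
    have "\<not> joins_horizontally W q"
    proof
      assume "joins_horizontally W q"
      then obtain P where "arc_invariant W P" "P (NW q)" "P (NE q)" "\<not> P (SW q)" "\<not> P (SE q)"
        using joins_horizontallyE(3) by metis
      then show False using L[of P "NW q" "SW q"] by (simp add: set_quad_eq)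
    qed
    moreover have "no_closed_component W q" unfolding no_closed_component_def
    proof (intro allI impI ballI)
      fix P b x assume P: "arc_invariant W P" "\<forall>x \<in> set_quad q. P x = b" and x: "x \<in> Field W"
      then show "P x = b" using L[of P x "NW q"] by (simp add: set_quad_eq)
    qed
    ultimately show ?R using assms by blast
  next
    assume R: ?R
    show ?L unfolding conn
    proof (intro allI impI)
      fix P assume P: "arc_invariant W P" "P (NW q) = P (NE q)" "P (SW q) = P (SE q)"
      then have corners: "\<forall>x \<in> set_quad q. P x = P (NW q)"
        using joins_verticallyE(1)[OF conjunct1[OF R] P(1)] by (simp add: set_quad_eq)
      then have "\<forall>x \<in> Field W. P x = P (NW q)"
        using R P(1) unfolding no_closed_component_def by blast
      then show "\<forall>x \<in> Field W \<union> set_quad q. \<forall>y \<in> Field W \<union> set_quad q. P x = P y"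
        using corners by (metis Un_iff)
    qed
  qed
qed

lemma connected_denominator_closure:
  assumes "joins_horizontally W q \<or> joins_vertically W q"
  shows "connected_arcs (W \<union> set (closure_arcs 2 q)) \<longleftrightarrow>
    joins_horizontally W q \<and> no_closed_component W q"
proof -
  have "joins_horizontally W (transpose_quad q) \<or> joins_vertically W (transpose_quad q)"
    using assms by auto
  from connected_numerator_closure[OF this] show ?thesis
    unfolding closure_arcs_transpose by simp
qed

text \<open>
  The arcs of a horizontal sum of two states. With transposed quads these are the arcs of a vertical
  sum.
\<close>

definition glue :: "('a \<times> 'a) set \<Rightarrow> 'a quad \<Rightarrow> ('b \<times> 'b) set \<Rightarrow> 'b quad \<Rightarrow> (('a + 'b) \<times> ('a + 'b)) set" where
  "glue W q W' q' = map_prod Inl Inl ` W \<union> map_prod Inr Inr ` W' \<union>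
     {(Inl (NE q), Inr (NW q')), (Inl (SE q), Inr (SW q'))}"

definition glue_quad :: "'a quad \<Rightarrow> 'b quad \<Rightarrow> ('a + 'b) quad" where
  "glue_quad q q' = Quad (Inl (NW q)) (Inr (NE q')) (Inl (SW q)) (Inr (SE q'))"

text \<open>
  An invariant predicate of the closed sum is a pair of invariant predicates of the summands that
  respects the four arcs added between the ends.
\<close>

lemma connected_glue_closure_iff:
  assumes e: "e = 1 \<or> e = 2"
  shows "connected_arcs (glue W q W' q' \<union> set (closure_arcs e (glue_quad q q'))) \<longleftrightarrow>
    (\<forall>P P'. arc_invariant W P \<longrightarrow> arc_invariant W' P' \<longrightarrow>
      P (NE q) = P' (NW q') \<longrightarrow> P (SE q) = P' (SW q') \<longrightarrow>
      (if e = 1 then P (NW q) = P' (NE q') \<and> P (SW q) = P' (SE q')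
       else P (NW q) = P (SW q) \<and> P' (NE q') = P' (SE q')) \<longrightarrow>
      (\<forall>x \<in> Field W \<union> set_quad q. P x = P (NW q)) \<and>
      (\<forall>x \<in> Field W' \<union> set_quad q'. P' x = P (NW q)))" (is "?L \<longleftrightarrow> ?R")
proof -
  let ?G = "glue W q W' q' \<union> set (closure_arcs e (glue_quad q q'))"
  have img: "Field (map_prod f f ` V) = f ` Field V" for f :: "'c \<Rightarrow> 'd" and V
    by (force simp: Field_def)
  have F: "Field ?G = Inl ` (Field W \<union> set_quad q) \<union> Inr ` (Field W' \<union> set_quad q')"
    using e by (auto simp: glue_def glue_quad_def closure_arcs_def set_quad_eq img Field_insert)
  have inv: "arc_invariant ?G Q \<longleftrightarrow> arc_invariant W (Q \<circ> Inl) \<and> arc_invariant W' (Q \<circ> Inr) \<and>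
      Q (Inl (NE q)) = Q (Inr (NW q')) \<and> Q (Inl (SE q)) = Q (Inr (SW q')) \<and>
      (if e = 1 then Q (Inl (NW q)) = Q (Inr (NE q')) \<and> Q (Inl (SW q)) = Q (Inr (SE q'))
       else Q (Inl (NW q)) = Q (Inl (SW q)) \<and> Q (Inr (NE q')) = Q (Inr (SE q')))" for Q
    using e by (elim disjE) (simp_all add: glue_def glue_quad_def closure_arcs_def conj_ac)
  show ?thesis
  proof
    assume L: ?L
    show ?R
    proof (intro allI impI)
      fix P P'
      assume "arc_invariant W P" "arc_invariant W' P'"
        "P (NE q) = P' (NW q')" "P (SE q) = P' (SW q')"
        "if e = 1 then P (NW q) = P' (NE q') \<and> P (SW q) = P' (SE q')
         else P (NW q) = P (SW q) \<and> P' (NE q') = P' (SE q')"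
      then have "arc_invariant ?G (case_sum P P')" unfolding inv by (simp add: case_sum_o_inj)
      then have "\<forall>x \<in> Field ?G. \<forall>y \<in> Field ?G. case_sum P P' x = case_sum P P' y"
        using L unfolding connected_arcs_def by blast
      moreover have "Inl (NW q) \<in> Field ?G" unfolding F by (simp add: set_quad_eq)
      ultimately have "\<forall>x \<in> Field ?G. case_sum P P' x = case_sum P P' (Inl (NW q))" by blast
      then show "(\<forall>x \<in> Field W \<union> set_quad q. P x = P (NW q)) \<and>
          (\<forall>x \<in> Field W' \<union> set_quad q'. P' x = P (NW q))"
        unfolding F ball_Un ball_simps by simp
    qed
  next
    assume R: ?R
    show ?L unfolding connected_arcs_def
    proof (intro allI impI)
      fix Q assume Q: "arc_invariant ?G Q"
      have "(\<forall>x \<in> Field W \<union> set_quad q. (Q \<circ> Inl) x = (Q \<circ> Inl) (NW q)) \<and>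
          (\<forall>x \<in> Field W' \<union> set_quad q'. (Q \<circ> Inr) x = (Q \<circ> Inl) (NW q))"
        by (rule R[rule_format]) (use Q[unfolded inv] in \<open>simp_all add: comp_def split: if_splits\<close>)
      then have "\<forall>x \<in> Field ?G. Q x = Q (Inl (NW q))" unfolding F by auto
      then show "\<forall>x \<in> Field ?G. \<forall>y \<in> Field ?G. Q x = Q y" by metis
    qed
  qed
qed

lemma connected_glueD:
  assumes "e = 1 \<or> e = 2"
    and "connected_arcs (glue W q W' q' \<union> set (closure_arcs e (glue_quad q q')))"
    and "arc_invariant W P" "arc_invariant W' P'"
    and "P (NE q) = P' (NW q')" "P (SE q) = P' (SW q')"
    and "if e = 1 then P (NW q) = P' (NE q') \<and> P (SW q) = P' (SE q')
      else P (NW q) = P (SW q) \<and> P' (NE q') = P' (SE q')"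
  shows "x \<in> Field W \<union> set_quad q \<Longrightarrow> P x = P (NW q)"
    and "x' \<in> Field W' \<union> set_quad q' \<Longrightarrow> P' x' = P (NW q)"
proof -
  have "(\<forall>x \<in> Field W \<union> set_quad q. P x = P (NW q)) \<and>
      (\<forall>x \<in> Field W' \<union> set_quad q'. P' x = P (NW q))"
    by (rule assms(2)[unfolded connected_glue_closure_iff[OF assms(1)], THEN spec, THEN spec,
          THEN mp, THEN mp, THEN mp, THEN mp, THEN mp]) (fact assms)+
  then show "x \<in> Field W \<union> set_quad q \<Longrightarrow> P x = P (NW q)"
    and "x' \<in> Field W' \<union> set_quad q' \<Longrightarrow> P' x' = P (NW q)"
    by blast+
qed

text \<open>
  A predicate that separates a closed component from the outer ends of its summand extends by a
  constant to the other summand.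
\<close>

lemma connected_glue_no_closed:
  assumes e: "e = 1 \<or> e = 2"
    and c: "connected_arcs (glue W q W' q' \<union> set (closure_arcs e (glue_quad q q')))"
  shows "no_closed_component W q" "no_closed_component W' q'"
proof -
  show "no_closed_component W q" unfolding no_closed_component_def
  proof (intro allI impI ballI)
    fix P b x assume P: "arc_invariant W P" "\<forall>x \<in> set_quad q. P x = b" and x: "x \<in> Field W"
    have "P x = P (NW q)"
      by (rule connected_glueD(1)[OF e c P(1) arc_invariant_const[of W' b]])
        (use P(2) x in \<open>simp_all add: set_quad_eq\<close>)
    then show "P x = b" using P(2) by (simp add: set_quad_eq)
  qed
  show "no_closed_component W' q'" unfolding no_closed_component_def
  proof (intro allI impI ballI)
    fix P b x assume P: "arc_invariant W' P" "\<forall>x \<in> set_quad q'. P x = b" and x: "x \<in> Field W'"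
    show "P x = b"
      by (rule connected_glueD(2)[OF e c arc_invariant_const[of W b] P(1)])
        (use P(2) x in \<open>simp_all add: set_quad_eq\<close>)
  qed
qed

lemma glue_constant:
  assumes "no_closed_component W q" "no_closed_component W' q'"
    and "arc_invariant W P" "arc_invariant W' P'"
    and "\<forall>x \<in> set_quad q. P x = b" "\<forall>x \<in> set_quad q'. P' x = b"
  shows "(\<forall>x \<in> Field W \<union> set_quad q. P x = b) \<and> (\<forall>x \<in> Field W' \<union> set_quad q'. P' x = b)"
  using no_closed_componentD[OF assms(1,3,5)] no_closed_componentD[OF assms(2,4,6)]
  by (intro conjI ballI)

text \<open>
  For summands of the same type, suitable separating predicates of the two summands fit together on
  all four joined pairs, so there are at least two circles. For summands of different types, the two
  conditions on each summand and the four joints identify all eight ends.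
\<close>

lemma connected_glue_numerator:
  assumes W: "joins_horizontally W q \<or> joins_vertically W q"
    and W': "joins_horizontally W' q' \<or> joins_vertically W' q'"
  shows "connected_arcs (glue W q W' q' \<union> set (closure_arcs 1 (glue_quad q q'))) \<longleftrightarrow>
    no_closed_component W q \<and> no_closed_component W' q' \<and>
    (joins_vertically W q \<and> joins_horizontally W' q' \<or> joins_horizontally W q \<and> joins_vertically W' q')"
    (is "?L \<longleftrightarrow> ?R")
proof
  assume L: ?L
  have one: "(1 :: nat) = 1 \<or> (1 :: nat) = 2" by simp
  have "\<not> (joins_horizontally W q \<and> joins_horizontally W' q')"
  proof
    assume h: "joins_horizontally W q \<and> joins_horizontally W' q'"
    obtain P where "arc_invariant W P" "P (NW q)" "P (NE q)" "\<not> P (SW q)" "\<not> P (SE q)"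
      using joins_horizontallyE(3) h by metis
    moreover obtain P' where "arc_invariant W' P'" "P' (NW q')" "P' (NE q')" "\<not> P' (SW q')" "\<not> P' (SE q')"
      using joins_horizontallyE(3) h by metis
    ultimately show False using connected_glueD(1)[OF one L, of P P' "SW q"] by (simp add: set_quad_eq)
  qed
  moreover have "\<not> (joins_vertically W q \<and> joins_vertically W' q')"
  proof
    assume v: "joins_vertically W q \<and> joins_vertically W' q'"
    obtain P where "arc_invariant W P" "P (NW q)" "P (SW q)" "\<not> P (NE q)" "\<not> P (SE q)"
      using joins_verticallyE(3) v by metis
    moreover obtain P' where "arc_invariant W' P'" "P' (NW q')" "P' (SW q')" "\<not> P' (NE q')" "\<not> P' (SE q')"
      using joins_verticallyE(3) v by metis
    \<comment> \<open>The east ends of the first state meet the west ends of the second, so the colours of the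
    second one have to be exchanged.\<close>
    then have "arc_invariant W' (\<lambda>x. \<not> P' x)" "\<not> \<not> P' (NW q')" "\<not> \<not> P' (SW q')"
        "\<not> P' (NE q')" "\<not> P' (SE q')"
      by (auto simp: arc_invariant_def)
    ultimately show False
      using connected_glueD(1)[OF one L, of P "\<lambda>x. \<not> P' x" "NE q"] by (simp add: set_quad_eq)
  qed
  ultimately show ?R using W W' connected_glue_no_closed[OF one L] by blast
next
  assume R: ?R
  have one: "(1 :: nat) = 1 \<or> (1 :: nat) = 2" by simp
  show ?L unfolding connected_glue_closure_iff[OF one]
  proof (intro allI impI glue_constant)
    fix P P'
    assume P: "arc_invariant W P" "arc_invariant W' P'"
      "P (NE q) = P' (NW q')" "P (SE q) = P' (SW q')"
      "if (1 :: nat) = 1 then P (NW q) = P' (NE q') \<and> P (SW q) = P' (SE q')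
       else P (NW q) = P (SW q) \<and> P' (NE q') = P' (SE q')"
    have "joins_vertically W q \<and> joins_horizontally W' q' \<or> joins_horizontally W q \<and> joins_vertically W' q'"
      using R by blast
    then show "\<forall>x \<in> set_quad q. P x = P (NW q)" "\<forall>x \<in> set_quad q'. P' x = P (NW q)"
      using joins_verticallyE(1,2)[of W q P] joins_horizontallyE(1,2)[of W q P]
        joins_verticallyE(1,2)[of W' q' P'] joins_horizontallyE(1,2)[of W' q' P'] P
      by (auto simp: set_quad_eq)
  qed (use R in auto)
qed

text \<open>
  A vertical summand lets its own outer path be closed up by the arc of the closure on that side, which
  separates it from the rest.
\<close>

lemma connected_glue_denominator:
  assumes W: "joins_horizontally W q \<or> joins_vertically W q"
    and W': "joins_horizontally W' q' \<or> joins_vertically W' q'"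
  shows "connected_arcs (glue W q W' q' \<union> set (closure_arcs 2 (glue_quad q q'))) \<longleftrightarrow>
    no_closed_component W q \<and> no_closed_component W' q' \<and>
    joins_horizontally W q \<and> joins_horizontally W' q'"
    (is "?L \<longleftrightarrow> ?R")
proof
  assume L: ?L
  have two: "(2 :: nat) = 1 \<or> (2 :: nat) = 2" by simp
  have "\<not> joins_vertically W q"
  proof
    assume "joins_vertically W q"
    then obtain P where "arc_invariant W P" "P (NW q)" "P (SW q)" "\<not> P (NE q)" "\<not> P (SE q)"
      using joins_verticallyE(3) by metis
    then show False using connected_glueD(1)[OF two L, of P "\<lambda>_. False" "NE q"]
      by (simp add: set_quad_eq arc_invariant_const)
  qed
  moreover have "\<not> joins_vertically W' q'"
  proof
    assume "joins_vertically W' q'"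
    then obtain P where "arc_invariant W' P" "P (NW q')" "P (SW q')" "\<not> P (NE q')" "\<not> P (SE q')"
      using joins_verticallyE(3) by metis
    then show False using connected_glueD(2)[OF two L, of "\<lambda>_. True" P "NE q'"]
      by (simp add: set_quad_eq arc_invariant_const)
  qed
  ultimately show ?R using W W' connected_glue_no_closed[OF two L] by blast
next
  assume R: ?R
  have two: "(2 :: nat) = 1 \<or> (2 :: nat) = 2" by simp
  show ?L unfolding connected_glue_closure_iff[OF two]
  proof (intro allI impI glue_constant)
    fix P P'
    assume P: "arc_invariant W P" "arc_invariant W' P'"
      "P (NE q) = P' (NW q')" "P (SE q) = P' (SW q')"
      "if (2 :: nat) = 1 then P (NW q) = P' (NE q') \<and> P (SW q) = P' (SE q')
       else P (NW q) = P (SW q) \<and> P' (NE q') = P' (SE q')"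
    show "\<forall>x \<in> set_quad q. P x = P (NW q)" "\<forall>x \<in> set_quad q'. P' x = P (NW q)"
      using joins_horizontallyE(1,2)[of W q P] joins_horizontallyE(1,2)[of W' q' P'] P R
      by (auto simp: set_quad_eq)
  qed (use R in auto)
qed

section \<open>States of tangle diagrams and of their sums\<close>

definition filled_state_arcs :: "'a tangle_diagram \<Rightarrow> nat list \<Rightarrow> bool list \<Rightarrow> ('a \<times> 'a) set" where
  "filled_state_arcs T \<alpha> \<sigma> = set (joints T) \<union> set (concat (map2 fundamental_arcs \<alpha> (holes T))) \<union>
     set (concat (map2 splitting \<sigma> (crossings T)))"

lemma smoothing_invariant_4:
  "smoothing_invariant t [a, b, c, d] P \<longleftrightarrow>
    (if t then P a = P b \<and> P c = P d else P b = P c \<and> P d = P a)"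
  by (cases t) (auto simp: smoothing_invariant_def partner_def All_less_Suc)

lemma smoothing_invariant_2: "smoothing_invariant t [a, b] P \<longleftrightarrow> P a = P b"
  by (cases t) (auto simp: smoothing_invariant_def partner_def All_less_Suc)

lemma smoothing_invariant_crossing:
  "smoothing_invariant t (crossing_cycle x) P \<longleftrightarrow> arc_invariant (set (splitting t x)) P"
  by (cases x; cases t) (simp_all add: smoothing_invariant_4)

lemma smoothing_invariant_joint:
  "smoothing_invariant t (joint_cycle x) P \<longleftrightarrow> arc_invariant {x} P"
  by (cases x) (simp add: smoothing_invariant_2)

text \<open>
  In the cyclic order NE, NW, SW, SE at a hole, the fundamental tangle 1 pairs the positions 1 with 2
  and 0 with 3, and the fundamental tangle 2 pairs 0 with 1 and 2 with 3.
\<close>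

lemma smoothing_invariant_hole:
  "smoothing_invariant (i \<noteq> 1) (hole_cycle q) P \<longleftrightarrow> arc_invariant (set (fundamental_arcs i q)) P"
  by (auto simp: hole_cycle_def smoothing_invariant_4 fundamental_arcs_def)

lemma arc_invariant_concat_map2:
  assumes "length xs = length ys"
  shows "arc_invariant (set (concat (map2 f xs ys))) P \<longleftrightarrow>
    list_all2 (\<lambda>x y. arc_invariant (set (f x y)) P) xs ys"
  using assms by (induction xs ys rule: list_induct2) simp_all

lemma even_cycles_vertex_cycles:
  assumes "punctured_ball_tangle_diagram n T"
  shows "even_cycles (vertex_cycles T)"
proof
  show "count_list (concat (vertex_cycles T)) a = 2" if "a \<in> edge_labels (vertex_cycles T)" for a
    using assms that by (simp add: punctured_ball_tangle_diagram_def)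
  have "length r = 2 \<or> length r = 4" if "r \<in> set (vertex_cycles T)" for r
  proof -
    have "length (crossing_cycle x) = 4" for x :: "'a crossing" by (cases x) simp
    moreover have "length (joint_cycle x) = 2" for x :: "'a \<times> 'a" by (cases x) simp
    ultimately show ?thesis
      using that by (auto simp: vertex_cycles_def hole_cycle_def outer_cycle_def)
  qed
  then show "r \<noteq> []" "even (length r)" if "r \<in> set (vertex_cycles T)" for r
    using that by fastforce+
qed

text \<open>
  A state of a filled diagram is a smoothing of all vertices but the outer one: crossings are smoothed
  by the state, holes by their filling, and joints in the only possible way.
\<close>

lemma filled_state_joins:
  assumes T: "punctured_ball_tangle_diagram n T"
    and \<alpha>: "length \<alpha> = n" and \<sigma>: "length \<sigma> = length (crossings T)"
  shows "joins_horizontally (filled_state_arcs T \<alpha> \<sigma>) (outer T) \<or>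
    joins_vertically (filled_state_arcs T \<alpha> \<sigma>) (outer T)"
proof -
  define R\<^sub>0 where "R\<^sub>0 = map crossing_cycle (crossings T) @ map joint_cycle (joints T) @ map hole_cycle (holes T)"
  define ts where "ts = \<sigma> @ map (\<lambda>_. True) (joints T) @ map (\<lambda>i. i \<noteq> 1) \<alpha>"
  have n: "length (holes T) = n" and planar: "planar_cycles (vertex_cycles T)"
    using T by (simp_all add: punctured_ball_tangle_diagram_def)
  have len: "length ts = length R\<^sub>0" using \<alpha> \<sigma> n by (simp add: ts_def R\<^sub>0_def)
  interpret even_cycles "vertex_cycles T" using even_cycles_vertex_cycles[OF T] .
  show ?thesis
  proof (rule smoothing_joins[OF planar])
    show "vertex_cycles T = R\<^sub>0 @ [outer_cycle (outer T)]" by (simp add: vertex_cycles_def R\<^sub>0_def)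
    fix P :: "'a \<Rightarrow> bool"
    have joint: "list_all2 (\<lambda>x y. P (fst y) = P (snd y)) js js \<longleftrightarrow> arc_invariant (set js) P" for js
      by (induction js) simp_all
    have "(\<forall>v < length R\<^sub>0. smoothing_invariant (ts ! v) (R\<^sub>0 ! v) P) \<longleftrightarrow>
        list_all2 (\<lambda>t r. smoothing_invariant t r P) ts R\<^sub>0"
      by (simp add: list_all2_conv_all_nth len)
    also have "\<dots> \<longleftrightarrow> arc_invariant (filled_state_arcs T \<alpha> \<sigma>) P"
      using \<alpha> \<sigma> n
      by (simp add: ts_def R\<^sub>0_def list_all2_append list_all2_map1 list_all2_map2
          smoothing_invariant_crossing smoothing_invariant_joint joint
          smoothing_invariant_hole[unfolded One_nat_def]
          filled_state_arcs_def arc_invariant_concat_map2 conj_ac del: set_concat)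
    finally show "arc_invariant (filled_state_arcs T \<alpha> \<sigma>) P \<longleftrightarrow>
        (\<forall>v < length R\<^sub>0. smoothing_invariant (ts ! v) (R\<^sub>0 ! v) P)" ..
  qed
qed

lemma splitting_map: "splitting t (map_crossing f x) = map (map_prod f f) (splitting t x)"
  by (cases x; cases t) simp_all

lemma concat_map2_splitting_map:
  "concat (map2 splitting \<sigma> (map (map_crossing f) xs)) =
    map (map_prod f f) (concat (map2 splitting \<sigma> xs))"
  by (simp add: zip_map2 map_concat o_def case_prod_unfold splitting_map)

lemma fundamental_arcs_map: "fundamental_arcs i (map_quad f q) = map (map_prod f f) (fundamental_arcs i q)"
  by (simp add: fundamental_arcs_def quad.map_sel)

lemma concat_map2_fundamental_arcs_map:
  "concat (map2 fundamental_arcs \<alpha> (map (map_quad f) xs)) =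
    map (map_prod f f) (concat (map2 fundamental_arcs \<alpha> xs))"
  by (simp add: zip_map2 map_concat o_def case_prod_unfold fundamental_arcs_map)

lemma filled_state_arcs_hsum:
  assumes "length \<alpha> = length (holes T)" "length \<sigma> = length (crossings T)"
  shows "filled_state_arcs (T +\<^sub>h T') (\<alpha> @ \<alpha>') (\<sigma> @ \<sigma>') =
    glue (filled_state_arcs T \<alpha> \<sigma>) (outer T) (filled_state_arcs T' \<alpha>' \<sigma>') (outer T')"
  using assms
  by (auto simp: filled_state_arcs_def hsum_def Let_def tangle_diagram.map_sel quad.map_sel glue_def
      concat_map2_splitting_map concat_map2_fundamental_arcs_map image_Un simp del: set_concat)

lemma filled_state_arcs_vsum:
  assumes "length \<alpha> = length (holes T)" "length \<sigma> = length (crossings T)"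
  shows "filled_state_arcs (T +\<^sub>v T') (\<alpha> @ \<alpha>') (\<sigma> @ \<sigma>') =
    glue (filled_state_arcs T \<alpha> \<sigma>) (transpose_quad (outer T))
      (filled_state_arcs T' \<alpha>' \<sigma>') (transpose_quad (outer T'))"
  using assms
  by (auto simp: filled_state_arcs_def vsum_def Let_def tangle_diagram.map_sel quad.map_sel glue_def
      concat_map2_splitting_map concat_map2_fundamental_arcs_map image_Un simp del: set_concat)

lemma hsum_sel:
  "length (crossings (T +\<^sub>h T')) = length (crossings T) + length (crossings T')"
  "outer (T +\<^sub>h T') = glue_quad (outer T) (outer T')"
  by (simp_all add: hsum_def Let_def tangle_diagram.map_sel quad.map_sel glue_quad_def)

lemma vsum_sel:
  "length (crossings (T +\<^sub>v T')) = length (crossings T) + length (crossings T')"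
  "outer (T +\<^sub>v T') = transpose_quad (glue_quad (transpose_quad (outer T)) (transpose_quad (outer T')))"
  by (simp_all add: vsum_def Let_def tangle_diagram.map_sel quad.map_sel glue_quad_def transpose_quad_def)

section \<open>The Kauffman bracket of a connect sum\<close>

definition one_circle :: "'a tangle_diagram \<Rightarrow> nat \<Rightarrow> nat list \<Rightarrow> bool list \<Rightarrow> bool" where
  "one_circle T e \<alpha> \<sigma> \<longleftrightarrow> connected_arcs (filled_state_arcs T \<alpha> \<sigma> \<union> set (closure_arcs e (outer T)))"

definition state_weight :: "bool list \<Rightarrow> complex" where
  "state_weight \<sigma> = kauffman_A powi (int (count_list \<sigma> True) - int (count_list \<sigma> False))"

lemma kauffman_A_loop_value: "- (kauffman_A powi 2) - kauffman_A powi (-2) = 0"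
proof -
  have "kauffman_A ^ 2 = exp (\<i> * of_real pi / 2)"
    by (simp add: kauffman_A_def flip: exp_double)
  also have "\<dots> = \<i>" using cis_pi_half by (simp add: cis_conv_exp)
  finally have sq: "kauffman_A ^ 2 = \<i>" .
  have "kauffman_A powi 2 = \<i>" "kauffman_A powi (-2) = - \<i>"
    by (simp_all add: power_int_def power_inverse sq)
  then show ?thesis by simp
qed

lemma state_weight_append: "state_weight (\<sigma> @ \<sigma>') = state_weight \<sigma> * state_weight \<sigma>'"
proof -
  have "kauffman_A \<noteq> 0" by (simp add: kauffman_A_def)
  then show ?thesis by (simp add: state_weight_def algebra_simps flip: power_int_add)
qed

lemma kauffman_bracket_fill_close:
  "kauffman_bracket (fill_close T e \<alpha>) =
    (\<Sum>\<sigma> | length \<sigma> = length (crossings T). state_weight \<sigma> * of_bool (one_circle T e \<alpha> \<sigma>))"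
proof -
  have "(0 :: complex) ^ (num_circles (state_arcs (fill_close T e \<alpha>) \<sigma>) - 1) =
      of_bool (one_circle T e \<alpha> \<sigma>)" for \<sigma>
  proof -
    let ?arcs = "state_arcs (fill_close T e \<alpha>) \<sigma>"
    have "?arcs \<noteq> []" by (simp add: state_arcs_def fill_close_def closure_arcs_def)
    note n = num_circles_eq_1_iff[OF this]
    have "set ?arcs = filled_state_arcs T \<alpha> \<sigma> \<union> set (closure_arcs e (outer T))"
      by (auto simp: state_arcs_def fill_close_def filled_state_arcs_def simp del: set_concat)
    then have "one_circle T e \<alpha> \<sigma> \<longleftrightarrow> num_circles ?arcs = 1" using n(1) by (simp add: one_circle_def)
    also have "\<dots> \<longleftrightarrow> num_circles ?arcs - 1 = 0" using n(2) by auto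
    finally show ?thesis by (simp add: power_0_left)
  qed
  then show ?thesis
    unfolding kauffman_bracket_def kauffman_A_loop_value state_weight_def
    by (simp add: fill_close_def)
qed

lemma sum_states_append:
  fixes f :: "bool list \<Rightarrow> 'c :: comm_monoid_add"
  shows "(\<Sum>\<sigma> | length \<sigma> = m + n. f \<sigma>) =
    (\<Sum>\<sigma> | length \<sigma> = m. \<Sum>\<sigma>' | length \<sigma>' = n. f (\<sigma> @ \<sigma>'))"
proof -
  have "bij_betw (\<lambda>(\<sigma>, \<sigma>'). \<sigma> @ \<sigma>') ({\<sigma> :: bool list. length \<sigma> = m} \<times> {\<sigma>'. length \<sigma>' = n})
      {\<sigma>. length \<sigma> = m + n}"
    by (rule bij_betwI[where g = "\<lambda>\<sigma>. (take m \<sigma>, drop m \<sigma>)"]) auto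
  from sum.reindex_bij_betw[OF this, of f] show ?thesis
    by (simp add: sum.cartesian_product case_prod_unfold)
qed

lemma one_circle_iff:
  assumes T: "punctured_ball_tangle_diagram n T"
    and \<alpha>: "length \<alpha> = n" and \<sigma>: "length \<sigma> = length (crossings T)"
  shows "one_circle T 1 \<alpha> \<sigma> \<longleftrightarrow> joins_vertically (filled_state_arcs T \<alpha> \<sigma>) (outer T) \<and>
      no_closed_component (filled_state_arcs T \<alpha> \<sigma>) (outer T)"
    and "one_circle T 2 \<alpha> \<sigma> \<longleftrightarrow> joins_horizontally (filled_state_arcs T \<alpha> \<sigma>) (outer T) \<and>
      no_closed_component (filled_state_arcs T \<alpha> \<sigma>) (outer T)"
  unfolding one_circle_def
  using connected_numerator_closure[OF filled_state_joins[OF assms]]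
    connected_denominator_closure[OF filled_state_joins[OF assms]] by blast+

context
  fixes T :: "'a tangle_diagram" and T' :: "'b tangle_diagram" and n n' :: nat and \<alpha> \<alpha>' :: "nat list"
  assumes T: "punctured_ball_tangle_diagram n T" and T': "punctured_ball_tangle_diagram n' T'"
    and \<alpha>: "length \<alpha> = n" and \<alpha>': "length \<alpha>' = n'"
begin

lemma num_holes: "length \<alpha> = length (holes T)"
  using T \<alpha> by (simp add: punctured_ball_tangle_diagram_def)

lemma one_circle_hsum:
  assumes \<sigma>: "length \<sigma> = length (crossings T)" and \<sigma>': "length \<sigma>' = length (crossings T')"
  shows "one_circle (T +\<^sub>h T') 1 (\<alpha> @ \<alpha>') (\<sigma> @ \<sigma>') \<longleftrightarrow>
      (one_circle T 1 \<alpha> \<sigma> \<and> one_circle T' 2 \<alpha>' \<sigma>' \<or> one_circle T 2 \<alpha> \<sigma> \<and> one_circle T' 1 \<alpha>' \<sigma>')"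
    and "one_circle (T +\<^sub>h T') 2 (\<alpha> @ \<alpha>') (\<sigma> @ \<sigma>') \<longleftrightarrow> one_circle T 2 \<alpha> \<sigma> \<and> one_circle T' 2 \<alpha>' \<sigma>'"
proof -
  note J = filled_state_joins[OF T \<alpha> \<sigma>] and J' = filled_state_joins[OF T' \<alpha>' \<sigma>']
  note S = one_circle_def[of "T +\<^sub>h T'"] filled_state_arcs_hsum[OF num_holes \<sigma>] hsum_sel
  show "one_circle (T +\<^sub>h T') 1 (\<alpha> @ \<alpha>') (\<sigma> @ \<sigma>') \<longleftrightarrow>
      (one_circle T 1 \<alpha> \<sigma> \<and> one_circle T' 2 \<alpha>' \<sigma>' \<or> one_circle T 2 \<alpha> \<sigma> \<and> one_circle T' 1 \<alpha>' \<sigma>')"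
    unfolding S connected_glue_numerator[OF J J'] one_circle_iff[OF T \<alpha> \<sigma>] one_circle_iff[OF T' \<alpha>' \<sigma>']
    by blast
  show "one_circle (T +\<^sub>h T') 2 (\<alpha> @ \<alpha>') (\<sigma> @ \<sigma>') \<longleftrightarrow> one_circle T 2 \<alpha> \<sigma> \<and> one_circle T' 2 \<alpha>' \<sigma>'"
    unfolding S connected_glue_denominator[OF J J'] one_circle_iff[OF T \<alpha> \<sigma>] one_circle_iff[OF T' \<alpha>' \<sigma>']
    by blast
qed

text \<open>
  The transposed vertical sum is the horizontal sum of the transposed states.
\<close>

lemma one_circle_vsum:
  assumes \<sigma>: "length \<sigma> = length (crossings T)" and \<sigma>': "length \<sigma>' = length (crossings T')"
  shows "one_circle (T +\<^sub>v T') 1 (\<alpha> @ \<alpha>') (\<sigma> @ \<sigma>') \<longleftrightarrow> one_circle T 1 \<alpha> \<sigma> \<and> one_circle T' 1 \<alpha>' \<sigma>'"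
    and "one_circle (T +\<^sub>v T') 2 (\<alpha> @ \<alpha>') (\<sigma> @ \<sigma>') \<longleftrightarrow>
      (one_circle T 1 \<alpha> \<sigma> \<and> one_circle T' 2 \<alpha>' \<sigma>' \<or> one_circle T 2 \<alpha> \<sigma> \<and> one_circle T' 1 \<alpha>' \<sigma>')"
proof -
  define W where "W = filled_state_arcs T \<alpha> \<sigma>"
  define W' where "W' = filled_state_arcs T' \<alpha>' \<sigma>'"
  have J: "joins_horizontally W (transpose_quad (outer T)) \<or> joins_vertically W (transpose_quad (outer T))"
    using filled_state_joins[OF T \<alpha> \<sigma>] by (auto simp: W_def)
  have J': "joins_horizontally W' (transpose_quad (outer T')) \<or> joins_vertically W' (transpose_quad (outer T'))"
    using filled_state_joins[OF T' \<alpha>' \<sigma>'] by (auto simp: W'_def)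
  note S = one_circle_def[of "T +\<^sub>v T'"] filled_state_arcs_vsum[OF num_holes \<sigma>] vsum_sel
    closure_arcs_transpose W_def[symmetric] W'_def[symmetric]
  note O = one_circle_iff[OF T \<alpha> \<sigma>, folded W_def] one_circle_iff[OF T' \<alpha>' \<sigma>', folded W'_def]
  show "one_circle (T +\<^sub>v T') 1 (\<alpha> @ \<alpha>') (\<sigma> @ \<sigma>') \<longleftrightarrow> one_circle T 1 \<alpha> \<sigma> \<and> one_circle T' 1 \<alpha>' \<sigma>'"
    unfolding S connected_glue_denominator[OF J J'] O no_closed_component_transpose by blast
  show "one_circle (T +\<^sub>v T') 2 (\<alpha> @ \<alpha>') (\<sigma> @ \<sigma>') \<longleftrightarrow>
      (one_circle T 1 \<alpha> \<sigma> \<and> one_circle T' 2 \<alpha>' \<sigma>' \<or> one_circle T 2 \<alpha> \<sigma> \<and> one_circle T' 1 \<alpha>' \<sigma>')"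
    unfolding S connected_glue_numerator[OF J J'] O no_closed_component_transpose
      transpose_quad_simps by blast
qed

lemma not_one_circle_both:
  assumes "length \<sigma> = length (crossings T)"
  shows "\<not> (one_circle T 1 \<alpha> \<sigma> \<and> one_circle T 2 \<alpha> \<sigma>)"
  unfolding one_circle_iff[OF T \<alpha> assms] using not_joins_both by blast

lemma kauffman_bracket_product:
  assumes "length (crossings S) = length (crossings T) + length (crossings T')"
    and "\<And>\<sigma> \<sigma>'. length \<sigma> = length (crossings T) \<Longrightarrow> length \<sigma>' = length (crossings T') \<Longrightarrow>
      one_circle S e \<beta> (\<sigma> @ \<sigma>') \<longleftrightarrow> one_circle T i \<alpha> \<sigma> \<and> one_circle T' j \<alpha>' \<sigma>'"
  shows "kauffman_bracket (fill_close S e \<beta>) =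
    kauffman_bracket (fill_close T i \<alpha>) * kauffman_bracket (fill_close T' j \<alpha>')"
  unfolding kauffman_bracket_fill_close assms(1) sum_states_append sum_product
  by (intro sum.cong refl) (simp add: assms(2) state_weight_append of_bool_conj)

text \<open>
  A state cannot give a single circle in both closures, so the two alternatives exclude each other
  and the indicator of their disjunction is the sum of two products.
\<close>

lemma kauffman_bracket_mixed_product:
  assumes "length (crossings S) = length (crossings T) + length (crossings T')"
    and "\<And>\<sigma> \<sigma>'. length \<sigma> = length (crossings T) \<Longrightarrow> length \<sigma>' = length (crossings T') \<Longrightarrow>
      one_circle S e \<beta> (\<sigma> @ \<sigma>') \<longleftrightarrow>
        (one_circle T 1 \<alpha> \<sigma> \<and> one_circle T' 2 \<alpha>' \<sigma>' \<or> one_circle T 2 \<alpha> \<sigma> \<and> one_circle T' 1 \<alpha>' \<sigma>')"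
  shows "kauffman_bracket (fill_close S e \<beta>) =
    kauffman_bracket (fill_close T 1 \<alpha>) * kauffman_bracket (fill_close T' 2 \<alpha>') +
    kauffman_bracket (fill_close T 2 \<alpha>) * kauffman_bracket (fill_close T' 1 \<alpha>')"
proof -
  have "state_weight (\<sigma> @ \<sigma>') * of_bool (one_circle S e \<beta> (\<sigma> @ \<sigma>')) =
      (state_weight \<sigma> * of_bool (one_circle T 1 \<alpha> \<sigma>)) * (state_weight \<sigma>' * of_bool (one_circle T' 2 \<alpha>' \<sigma>')) +
      (state_weight \<sigma> * of_bool (one_circle T 2 \<alpha> \<sigma>)) * (state_weight \<sigma>' * of_bool (one_circle T' 1 \<alpha>' \<sigma>'))"
    if "length \<sigma> = length (crossings T)" "length \<sigma>' = length (crossings T')" for \<sigma> \<sigma>'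
    using not_one_circle_both[OF that(1)] unfolding assms(2)[OF that] state_weight_append
    by (cases "one_circle T 1 \<alpha> \<sigma>"; cases "one_circle T 2 \<alpha> \<sigma>") simp_all
  then show ?thesis
    unfolding kauffman_bracket_fill_close assms(1) sum_states_append sum_product sum.distrib[symmetric]
    by (intro sum.cong refl) simp
qed

lemma kauffman_bracket_hsum:
  "kauffman_bracket (fill_close (T +\<^sub>h T') 1 (\<alpha> @ \<alpha>')) =
    kauffman_bracket (fill_close T 1 \<alpha>) * kauffman_bracket (fill_close T' 2 \<alpha>') +
    kauffman_bracket (fill_close T 2 \<alpha>) * kauffman_bracket (fill_close T' 1 \<alpha>')"
  "kauffman_bracket (fill_close (T +\<^sub>h T') 2 (\<alpha> @ \<alpha>')) =
    kauffman_bracket (fill_close T 2 \<alpha>) * kauffman_bracket (fill_close T' 2 \<alpha>')"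
  by (rule kauffman_bracket_mixed_product[OF hsum_sel(1) one_circle_hsum(1)]; assumption)
     (rule kauffman_bracket_product[OF hsum_sel(1) one_circle_hsum(2)]; assumption)

lemma kauffman_bracket_vsum:
  "kauffman_bracket (fill_close (T +\<^sub>v T') 1 (\<alpha> @ \<alpha>')) =
    kauffman_bracket (fill_close T 1 \<alpha>) * kauffman_bracket (fill_close T' 1 \<alpha>')"
  "kauffman_bracket (fill_close (T +\<^sub>v T') 2 (\<alpha> @ \<alpha>')) =
    kauffman_bracket (fill_close T 1 \<alpha>) * kauffman_bracket (fill_close T' 2 \<alpha>') +
    kauffman_bracket (fill_close T 2 \<alpha>) * kauffman_bracket (fill_close T' 1 \<alpha>')"
  by (rule kauffman_bracket_product[OF vsum_sel(1) one_circle_vsum(1)]; assumption)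
     (rule kauffman_bracket_mixed_product[OF vsum_sel(1) one_circle_vsum(2)]; assumption)

end

section \<open>The matrices of the invariant\<close>

lemma index_lists_Suc:
  "index_lists (Suc n) = map (Cons 1) (index_lists n) @ map (Cons 2) (index_lists n)"
  by (simp add: index_lists_def)

lemma length_index_lists: "length (index_lists n) = 2 ^ n"
  by (induction n) (simp_all add: index_lists_Suc, simp add: index_lists_def)

lemma length_index_lists_nth:
  assumes "l < 2 ^ n"
  shows "length (index_lists n ! l) = n"
proof -
  have "index_lists n ! l \<in> set (product_lists (replicate n [1, 2]))"
    unfolding index_lists_def[symmetric] using assms by (intro nth_mem) (simp add: length_index_lists)
  from in_set_product_lists_length[OF this] show ?thesis by simp
qed

lemma index_lists_add_nth:
  assumes "c < 2 ^ (m + n)"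
  shows "index_lists (m + n) ! c = index_lists m ! (c div 2 ^ n) @ index_lists n ! (c mod 2 ^ n)"
  using assms
proof (induction m arbitrary: c)
  case 0
  then show ?case by (simp add: index_lists_def)
next
  case (Suc m)
  show ?case
  proof (cases "c < 2 ^ (m + n)")
    case True
    then have "c div 2 ^ n < 2 ^ m" by (simp add: less_mult_imp_div_less power_add)
    then show ?thesis
      using True Suc.IH[OF True] by (simp add: index_lists_Suc nth_append length_index_lists)
  next
    case False
    define d where "d = c - 2 ^ (m + n)"
    have c: "c = d + 2 ^ m * 2 ^ n" using False by (simp add: d_def power_add)
    have d: "d < 2 ^ (m + n)" using Suc.prems c by (simp add: power_add)
    have div: "c div 2 ^ n = d div 2 ^ n + 2 ^ m" and mod: "c mod 2 ^ n = d mod 2 ^ n"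
      by (simp_all add: c)
    have "d div 2 ^ n < 2 ^ m" using d by (simp add: less_mult_imp_div_less power_add)
    then show ?thesis
      using Suc.IH[OF d] d c unfolding div mod
      by (simp add: index_lists_Suc nth_append length_index_lists power_add)
  qed
qed


lemma norm_Phi: "z \<in> Phi \<Longrightarrow> norm z = 1"
proof -
  assume "z \<in> Phi"
  then have "norm z ^ 8 = 1" by (simp add: Phi_def flip: norm_power)
  then show "norm z = 1" by (intro power_eq_imp_eq_base[of "norm z" 8 1]) simp_all
qed

text \<open>
  If \<open>z\<close> and \<open>w\<close> both give integer matrices, then these differ by the factor \<open>w / z\<close> of
  modulus 1. At a nonzero entry this factor is a quotient of integers, hence 1 or \<open>-1\<close>. The zero
  matrix is its own negative.
\<close>

lemma tangle_invariant_eq_pm_class: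
  assumes M: "M \<in> tangle_invariant n T"
  shows "tangle_invariant n T = pm_class M"
proof -
  obtain z where z: "z \<in> Phi" and Mz: "map_mat of_int M = invariant_matrix n T z"
    and Mc: "M \<in> carrier_mat 2 (2 ^ n)"
    using M by (auto simp: tangle_invariant_def)
  have scale: "invariant_matrix n T (u * z) = u \<cdot>\<^sub>m map_mat of_int M" for u
    unfolding Mz by (rule eq_matI) (auto simp: invariant_matrix_def Let_def)
  have "- M \<in> tangle_invariant n T"
  proof -
    have "map_mat of_int (- M) = invariant_matrix n T (- 1 * z)"
      unfolding scale using Mc by (intro eq_matI) auto
    moreover have "- 1 * z \<in> Phi" using z by (simp add: Phi_def)
    moreover have "- M \<in> carrier_mat 2 (2 ^ n)" using Mc by simp
    ultimately show ?thesis unfolding tangle_invariant_def by blast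
  qed
  moreover have "N = M \<or> N = - M" if N: "N \<in> tangle_invariant n T" for N
  proof -
    obtain w where w: "w \<in> Phi" and Nw: "map_mat of_int N = invariant_matrix n T w"
      and Nc: "N \<in> carrier_mat 2 (2 ^ n)"
      using N by (auto simp: tangle_invariant_def)
    define u where "u = w / z"
    have "z \<noteq> 0" using norm_Phi[OF z] by auto
    then have "map_mat of_int N = u \<cdot>\<^sub>m map_mat of_int M" unfolding Nw scale[symmetric] by (simp add: u_def)
    then have NM: "(map_mat of_int N :: complex mat) $$ (r, l) = (u \<cdot>\<^sub>m map_mat of_int M) $$ (r, l)" for r l
      by simp
    have entry: "of_int (N $$ (r, l)) = u * of_int (M $$ (r, l))" if "r < 2" "l < 2 ^ n" for r l
      using NM[of r l] that Mc Nc by simp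
    show ?thesis
    proof (cases "\<exists>r < 2. \<exists>l < 2 ^ n. M $$ (r, l) \<noteq> 0")
      case True
      then obtain r l where rl: "r < 2" "l < 2 ^ n" "M $$ (r, l) \<noteq> 0" by blast
      define x where "x = real_of_int (N $$ (r, l)) / real_of_int (M $$ (r, l))"
      have "u = of_real x" using entry[OF rl(1,2)] rl(3) by (simp add: x_def field_simps)
      moreover have "norm u = 1" using norm_Phi[OF z] norm_Phi[OF w] by (simp add: u_def norm_divide)
      ultimately have u: "u = 1 \<or> u = - 1" by (auto simp: abs_if split: if_splits)
      then show ?thesis
      proof
        assume "u = 1"
        then have "N = M" using entry Mc Nc by (intro eq_matI) auto
        then show ?thesis ..
      next
        assume "u = - 1"
        then have "of_int (N $$ (r, l)) = (of_int (- M $$ (r, l)) :: complex)" if "r < 2" "l < 2 ^ n" for r l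
          using entry[OF that] by simp
        then have "N $$ (r, l) = - M $$ (r, l)" if "r < 2" "l < 2 ^ n" for r l
          using that unfolding of_int_eq_iff by blast
        then have "N = - M" using Mc Nc by (intro eq_matI) auto
        then show ?thesis ..
      qed
    next
      case False
      then have "N $$ (r, l) = M $$ (r, l)" if "r < 2" "l < 2 ^ n" for r l
        using entry[OF that] that by simp
      then have "N = M" using Mc Nc by (intro eq_matI) auto
      then show ?thesis ..
    qed
  qed
  ultimately show ?thesis using M by (auto simp: pm_class_def)
qed

lemma invariant_matrix_entry:
  assumes "map_mat of_int M = invariant_matrix n T z" "M \<in> carrier_mat 2 (2 ^ n)" "r < 2" "l < 2 ^ n"
  shows "of_int (M $$ (r, l)) = (- \<i>) ^ count_list (index_lists n ! l) 2 * \<i> ^ r * z *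
    kauffman_bracket (fill_close T (Suc r) (index_lists n ! l))"
proof -
  have "(map_mat of_int M :: complex mat) $$ (r, l) = of_int (M $$ (r, l))" using assms(2-4) by simp
  then show ?thesis unfolding assms(1) using assms(3,4) by (simp add: invariant_matrix_def Let_def)
qed

lemma tangle_invariantI:
  assumes "z \<in> Phi"
    and "\<And>l. l < 2 ^ n \<Longrightarrow> of_int (f (0, l)) = (- \<i>) ^ count_list (index_lists n ! l) 2 * z *
      kauffman_bracket (fill_close T 1 (index_lists n ! l))"
    and "\<And>l. l < 2 ^ n \<Longrightarrow> of_int (f (1, l)) = (- \<i>) ^ count_list (index_lists n ! l) 2 * \<i> * z *
      kauffman_bracket (fill_close T 2 (index_lists n ! l))"
  shows "mat 2 (2 ^ n) f \<in> tangle_invariant n T"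
proof -
  have "map_mat of_int (mat 2 (2 ^ n) f) = invariant_matrix n T z"
  proof (rule eq_matI)
    fix r l assume "r < dim_row (invariant_matrix n T z)" "l < dim_col (invariant_matrix n T z)"
    then have l: "l < 2 ^ n" and "r = 0 \<or> r = 1" by (auto simp: invariant_matrix_def)
    then show "map_mat of_int (mat 2 (2 ^ n) f) $$ (r, l) = invariant_matrix n T z $$ (r, l)"
      using assms(2,3)[OF l] by (auto simp: invariant_matrix_def Let_def numeral_2_eq_2)
  qed (simp_all add: invariant_matrix_def)
  then show ?thesis unfolding tangle_invariant_def using assms(1) by auto
qed

theorem theorem3p3:
  fixes k\<^sub>1 k\<^sub>2 :: nat
    and T\<^sub>1 :: "'a tangle_diagram" and T\<^sub>2 :: "'b tangle_diagram"
    and a b :: "int mat"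
  assumes "punctured_ball_tangle_diagram k\<^sub>1 T\<^sub>1"
    and "punctured_ball_tangle_diagram k\<^sub>2 T\<^sub>2"
    and "a \<in> carrier_mat 2 (2 ^ k\<^sub>1)"
    and "b \<in> carrier_mat 2 (2 ^ k\<^sub>2)"
    and "tangle_invariant k\<^sub>1 T\<^sub>1 = pm_class a"
    and "tangle_invariant k\<^sub>2 T\<^sub>2 = pm_class b"
  shows "tangle_invariant (k\<^sub>1 + k\<^sub>2) (T\<^sub>1 +\<^sub>h T\<^sub>2) =
      pm_class (mat 2 (2 ^ (k\<^sub>1 + k\<^sub>2)) (\<lambda>(r, c).
        let i = c div 2 ^ k\<^sub>2; j = c mod 2 ^ k\<^sub>2 in
          if r = 0 then a $$ (0, i) * b $$ (1, j) + a $$ (1, i) * b $$ (0, j)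
          else a $$ (1, i) * b $$ (1, j)))
    \<and> tangle_invariant (k\<^sub>1 + k\<^sub>2) (T\<^sub>1 +\<^sub>v T\<^sub>2) =
      pm_class (mat 2 (2 ^ (k\<^sub>1 + k\<^sub>2)) (\<lambda>(r, c).
        let i = c div 2 ^ k\<^sub>2; j = c mod 2 ^ k\<^sub>2 in
          if r = 0 then a $$ (0, i) * b $$ (0, j)
          else a $$ (1, i) * b $$ (0, j) + a $$ (0, i) * b $$ (1, j)))"
proof -
  have "a \<in> tangle_invariant k\<^sub>1 T\<^sub>1" "b \<in> tangle_invariant k\<^sub>2 T\<^sub>2"
    using assms(5,6) by (simp_all add: pm_class_def)
  then obtain z w where z: "z \<in> Phi" "map_mat of_int a = invariant_matrix k\<^sub>1 T\<^sub>1 z"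
    and w: "w \<in> Phi" "map_mat of_int b = invariant_matrix k\<^sub>2 T\<^sub>2 w"
    by (auto simp: tangle_invariant_def)
  note a = invariant_matrix_entry[OF z(2) assms(3)] and b = invariant_matrix_entry[OF w(2) assms(4)]
  have zw: "z * w \<in> Phi" "\<i> * (z * w) \<in> Phi"
    using z(1) w(1) by (simp_all add: Phi_def power_mult_distrib)
  define N where "N e i = kauffman_bracket (fill_close T\<^sub>1 e (index_lists k\<^sub>1 ! i))" for e i
  define N' where "N' e j = kauffman_bracket (fill_close T\<^sub>2 e (index_lists k\<^sub>2 ! j))" for e j
  define s where "s i = (- \<i>) ^ count_list (index_lists k\<^sub>1 ! i) 2" for i
  define s' where "s' j = (- \<i>) ^ count_list (index_lists k\<^sub>2 ! j) 2" for j
  have a0: "of_int (a $$ (0, i)) = s i * z * N 1 i" and a1: "of_int (a $$ (1, i)) = s i * \<i> * z * N 2 i"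
    if "i < 2 ^ k\<^sub>1" for i
    using a[of 0 i] a[of 1 i] that by (simp_all add: s_def N_def numeral_2_eq_2)
  have b0: "of_int (b $$ (0, j)) = s' j * w * N' 1 j" and b1: "of_int (b $$ (1, j)) = s' j * \<i> * w * N' 2 j"
    if "j < 2 ^ k\<^sub>2" for j
    using b[of 0 j] b[of 1 j] that by (simp_all add: s'_def N'_def numeral_2_eq_2)
  have col: "c div 2 ^ k\<^sub>2 < 2 ^ k\<^sub>1" "c mod 2 ^ k\<^sub>2 < 2 ^ k\<^sub>2"
    if "c < 2 ^ (k\<^sub>1 + k\<^sub>2)" for c :: nat
    using that by (simp_all add: less_mult_imp_div_less power_add)
  have sign: "(- \<i>) ^ count_list (index_lists (k\<^sub>1 + k\<^sub>2) ! c) 2 = s (c div 2 ^ k\<^sub>2) * s' (c mod 2 ^ k\<^sub>2)"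
    if "c < 2 ^ (k\<^sub>1 + k\<^sub>2)" for c
    using that by (simp add: index_lists_add_nth s_def s'_def power_add)
  note len = length_index_lists_nth[OF col(1)] length_index_lists_nth[OF col(2)]
  have h: "kauffman_bracket (fill_close (T\<^sub>1 +\<^sub>h T\<^sub>2) 1 (index_lists (k\<^sub>1 + k\<^sub>2) ! c)) =
      N 1 (c div 2 ^ k\<^sub>2) * N' 2 (c mod 2 ^ k\<^sub>2) + N 2 (c div 2 ^ k\<^sub>2) * N' 1 (c mod 2 ^ k\<^sub>2)"
    "kauffman_bracket (fill_close (T\<^sub>1 +\<^sub>h T\<^sub>2) 2 (index_lists (k\<^sub>1 + k\<^sub>2) ! c)) =
      N 2 (c div 2 ^ k\<^sub>2) * N' 2 (c mod 2 ^ k\<^sub>2)"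
    if "c < 2 ^ (k\<^sub>1 + k\<^sub>2)" for c
    unfolding index_lists_add_nth[OF that] N_def N'_def
    by (rule kauffman_bracket_hsum[OF assms(1,2) len(1)[OF that] len(2)[OF that]])+
  have v: "kauffman_bracket (fill_close (T\<^sub>1 +\<^sub>v T\<^sub>2) 1 (index_lists (k\<^sub>1 + k\<^sub>2) ! c)) =
      N 1 (c div 2 ^ k\<^sub>2) * N' 1 (c mod 2 ^ k\<^sub>2)"
    "kauffman_bracket (fill_close (T\<^sub>1 +\<^sub>v T\<^sub>2) 2 (index_lists (k\<^sub>1 + k\<^sub>2) ! c)) =
      N 1 (c div 2 ^ k\<^sub>2) * N' 2 (c mod 2 ^ k\<^sub>2) + N 2 (c div 2 ^ k\<^sub>2) * N' 1 (c mod 2 ^ k\<^sub>2)"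
    if "c < 2 ^ (k\<^sub>1 + k\<^sub>2)" for c
    unfolding index_lists_add_nth[OF that] N_def N'_def
    by (rule kauffman_bracket_vsum[OF assms(1,2) len(1)[OF that] len(2)[OF that]])+
  show ?thesis
  proof (intro conjI tangle_invariant_eq_pm_class, goal_cases)
    case 1
    show ?case
      by (rule tangle_invariantI[OF zw(2)])
        (simp_all only: Let_def prod.case if_True if_False one_neq_zero refl
          of_int_add of_int_mult sign h a0 a1 b0 b1 col, simp_all add: algebra_simps)
  next
    case 2
    show ?case
      by (rule tangle_invariantI[OF zw(1)])
        (simp_all only: Let_def prod.case if_True if_False one_neq_zero refl
          of_int_add of_int_mult sign v a0 a1 b0 b1 col, simp_all add: algebra_simps)
  qed
qed

end
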